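(* Let $\mathfrak{I}$ be a polynomial ideal in $\mathbb{K}[x_1,\ldots,x_n,u_1,\ldots,u_m]$, where $\mathbb{K}$ is a field. Let $$S:=\bigcup\{\,C_\prec(\mathfrak{I})\;:\;\prec \text{ is an } \mathfrak{I}\text{-specific elimination order for the elimination of } u_1,\ldots,u_m\,\}\subseteq\mathbb{R}^{n+m}_{\ge 0}$$ be the union of the Gröbner cones of all $\mathfrak{I}$-specific elimination orders for the elimination of $u_1,\ldots,u_m$ from $\mathfrak{I}$. Then $S$ is star-shaped with center $$\Omega_u:=\{\omega\in\mathbb{R}_{\ge 0}^{n+m}\;:\;\omega_1=0,\ldots,\omega_n=0\},$$ that is, $\Omega_u\subseteq S$, and for all $s\in S$ and $c\in\Omega_u$ the segment $\overline{cs}$ is contained in $S$.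
   Context: Write $\mathbb{K}[X]=\mathbb{K}[x_1,\ldots,x_n]$, $\mathbb{K}[X][U]=\mathbb{K}[x_1,\ldots,x_n,u_1,\ldots,u_m]$, and $(y_1,\ldots,y_{n+m})=(x_1,\ldots,x_n,u_1,\ldots,u_m)$; for $\alpha\in\mathbb{N}^{n+m}$ put $y^\alpha=\prod_i y_i^{\alpha_i}$. The first $n$ coordinates of a vector in $\mathbb{R}^{n+m}$ correspond to the $x$-variables, the last $m$ to the $u$-variables. For a monomial order $\prec$ on $\mathbb{K}[X][U]$, $\mathrm{lt}_\prec(f)$ is the leading term of $f\neq 0$, and $\langle \mathrm{lt}_\prec(\mathfrak{I})\rangle$ is the ideal generated by all leading terms of nonzero elements of $\mathfrak{I}$. A Gröbner basis $G$ is reduced if for all $g\ne h$ in $G$, $\mathrm{lt}_\prec(g)$ divides no monomial of $h$; it is normed if all leading coefficients are $1$. $\underline{GB}(\mathfrak{I},\prec)$ denotes the unique finite normed reduced Gröbner basis of $\mathfrak{I}$ with respect to $\prec$. Weight vectors are the elements of $\Omega:=\mathbb{R}^{n+m}_{\ge 0}$. For $f=\sum_\alpha f_\alpha y^\alpha\ne 0$ and $\omega\in\Omega$, $\deg_\omega(f):=\max\{\omega^T\alpha : f_\alpha\ne0\}$, and $\mathrm{lt}_\omega(f):=\sum_{\alpha\in A} f_\alpha y^\alpha$ with $A=\{\alpha\in\mathbb{N}^{n+m}: f_\alpha\neq 0,\ \omega^T\alpha=\deg_\omega(f)\}$. $\langle\mathrm{lt}_\omega(\mathfrak{I})\rangle$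 is the ideal generated by all $\mathrm{lt}_\omega(f)$, $0\neq f\in\mathfrak{I}$. The Gröbner cone of $\mathfrak{I}$ with respect to $\prec$ is $C_\prec(\mathfrak{I}):=\mathrm{closure}(\{\omega\in\Omega : \langle\mathrm{lt}_\omega(\mathfrak{I})\rangle=\langle\mathrm{lt}_\prec(\mathfrak{I})\rangle\})$, closure in the standard topology of $\mathbb{R}^{n+m}$. A monomial order $\prec$ is an $\mathfrak{I}$-specific elimination order for the elimination of $u_1,\ldots,u_m$ if for all $g\in\underline{GB}(\mathfrak{I},\prec)$: $\mathrm{lt}_\prec(g)\in\mathbb{K}[X]$ implies $g\in\mathbb{K}[X]$. A set $S\subseteq\mathbb{R}^{n+m}$ is called star-shaped with center $C\subseteq S$ if for any $s\in S$ and $c\in C$ the segment $\overline{cs}$ is contained in $S$. *)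

theory Defs
  imports "HOL-Analysis.Analysis" "HOL-Library.Poly_Mapping"
begin

text \<open>
  The variables \<open>y\<^sub>1, \<dots>, y\<^bsub>n+m\<^esub>\<close> are the elements of a finite type \<open>'v\<close>. Wherever the
  distinction matters, a set \<open>U :: 'v set\<close> collects the variables \<open>u\<^sub>1, \<dots>, u\<^sub>m\<close> and its
  complement the variables \<open>x\<^sub>1, \<dots>, x\<^sub>n\<close>. Either of the two sets may be empty.
  A polynomial maps exponent vectors to coefficients; its set of keys is its support.
\<close>

type_synonym 'v expo = "'v \<Rightarrow>\<^sub>0 nat"
type_synonym ('v, 'k) mpoly = "'v expo \<Rightarrow>\<^sub>0 'k"

text \<open>\<open>ideal.subspace I\<close>: \<open>I\<close> is an ideal; \<open>ideal.span B\<close>: the ideal generated by \<open>B\<close>.\<close>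

global_interpretation ideal: module "(*) :: 'a::comm_ring_1 \<Rightarrow> 'a \<Rightarrow> 'a"
  by unfold_locales (simp_all add: algebra_simps)

text \<open>\<open>R\<close> is the strict relation: \<open>(\<alpha>, \<beta>) \<in> R\<close> means that \<open>y\<^sup>\<alpha>\<close> is smaller than \<open>y\<^sup>\<beta>\<close>.\<close>

definition monomial_order :: "'v expo rel \<Rightarrow> bool" where
  "monomial_order R \<longleftrightarrow> strict_linear_order R \<and>
     (\<forall>\<alpha>. \<alpha> \<noteq> 0 \<longrightarrow> (0, \<alpha>) \<in> R) \<and>
     (\<forall>\<alpha> \<beta> \<gamma>. (\<alpha>, \<beta>) \<in> R \<longrightarrow> (\<alpha> + \<gamma>, \<beta> + \<gamma>) \<in> R)"

definition lead_expo :: "'v expo rel \<Rightarrow> ('v, 'k::zero) mpoly \<Rightarrow> 'v expo" where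
  "lead_expo R f = (THE \<alpha>. \<alpha> \<in> Poly_Mapping.keys f \<and> (\<forall>\<beta>\<in>Poly_Mapping.keys f. \<beta> \<noteq> \<alpha> \<longrightarrow> (\<beta>, \<alpha>) \<in> R))"

definition leading_coeff :: "'v expo rel \<Rightarrow> ('v, 'k::zero) mpoly \<Rightarrow> 'k" where
  "leading_coeff R f = Poly_Mapping.lookup f (lead_expo R f)"

text \<open>Leading terms include the coefficient, as the weighted leading forms below do.\<close>

definition lead_term :: "'v expo rel \<Rightarrow> ('v, 'k::zero) mpoly \<Rightarrow> ('v, 'k) mpoly" where
  "lead_term R f = Poly_Mapping.single (lead_expo R f) (leading_coeff R f)"

definition lead_ideal :: "'v expo rel \<Rightarrow> ('v, 'k::field) mpoly set \<Rightarrow> ('v, 'k) mpoly set" where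
  "lead_ideal R I = ideal.span {lead_term R f | f. f \<in> I \<and> f \<noteq> 0}"

definition groebner_basis :: "'v expo rel \<Rightarrow> ('v, 'k::field) mpoly set \<Rightarrow> ('v, 'k) mpoly set \<Rightarrow> bool" where
  "groebner_basis R I G \<longleftrightarrow> finite G \<and> G \<subseteq> I \<and> 0 \<notin> G \<and>
     ideal.span (lead_term R ` G) = lead_ideal R I"

definition reduced_basis :: "'v expo rel \<Rightarrow> ('v, 'k::field) mpoly set \<Rightarrow> bool" where
  "reduced_basis R G \<longleftrightarrow> (\<forall>g\<in>G. \<forall>h\<in>G. g \<noteq> h \<longrightarrow>
     (\<forall>\<beta>\<in>Poly_Mapping.keys h. \<not> lead_term R g dvd Poly_Mapping.single \<beta> 1))"

definition normed_basis :: "'v expo rel \<Rightarrow> ('v, 'k::field) mpoly set \<Rightarrow> bool" where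
  "normed_basis R G \<longleftrightarrow> (\<forall>g\<in>G. leading_coeff R g = 1)"

definition reduced_GB :: "'v expo rel \<Rightarrow> ('v, 'k::field) mpoly set \<Rightarrow> ('v, 'k) mpoly set" where
  "reduced_GB R I = (THE G. groebner_basis R I G \<and> reduced_basis R G \<and> normed_basis R G)"

definition nonneg_weights :: "(real ^ 'v::finite) set" where
  "nonneg_weights = {\<omega>. \<forall>i. 0 \<le> \<omega> $ i}"

definition weight :: "real ^ 'v::finite \<Rightarrow> 'v expo \<Rightarrow> real" where
  "weight \<omega> \<alpha> = \<omega> \<bullet> (\<chi> i. real (Poly_Mapping.lookup \<alpha> i))"

definition wdeg :: "real ^ 'v::finite \<Rightarrow> ('v, 'k::zero) mpoly \<Rightarrow> real" where
  "wdeg \<omega> f = Max (weight \<omega> ` Poly_Mapping.keys f)"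

definition wlead_form :: "real ^ 'v::finite \<Rightarrow> ('v, 'k::field) mpoly \<Rightarrow> ('v, 'k) mpoly" where
  "wlead_form \<omega> f =
     (\<Sum>\<alpha> | \<alpha> \<in> Poly_Mapping.keys f \<and> weight \<omega> \<alpha> = wdeg \<omega> f. Poly_Mapping.single \<alpha> (Poly_Mapping.lookup f \<alpha>))"

definition wlead_ideal :: "real ^ 'v::finite \<Rightarrow> ('v, 'k::field) mpoly set \<Rightarrow> ('v, 'k) mpoly set" where
  "wlead_ideal \<omega> I = ideal.span {wlead_form \<omega> f | f. f \<in> I \<and> f \<noteq> 0}"

definition groebner_cone :: "'v expo rel \<Rightarrow> ('v::finite, 'k::field) mpoly set \<Rightarrow> (real ^ 'v) set" where
  "groebner_cone R I = closure {\<omega> \<in> nonneg_weights. wlead_ideal \<omega> I = lead_ideal R I}"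

text \<open>The subring \<open>K[X]\<close> of the polynomials in which no variable from \<open>U\<close> occurs.\<close>

definition polys_without :: "'v set \<Rightarrow> ('v, 'k::zero) mpoly set" where
  "polys_without U = {f. \<forall>\<alpha>\<in>Poly_Mapping.keys f. Poly_Mapping.keys \<alpha> \<inter> U = {}}"

definition specific_elim_order ::
    "'v set \<Rightarrow> ('v, 'k::field) mpoly set \<Rightarrow> 'v expo rel \<Rightarrow> bool" where
  "specific_elim_order U I R \<longleftrightarrow> monomial_order R \<and>
     (\<forall>g\<in>reduced_GB R I. lead_term R g \<in> polys_without U \<longrightarrow> g \<in> polys_without U)"

definition star_shaped :: "'a::real_vector set \<Rightarrow> 'a set \<Rightarrow> bool" where
  "star_shaped S C \<longleftrightarrow> C \<subseteq> S \<and> (\<forall>s\<in>S. \<forall>c\<in>C. closed_segment c s \<subseteq> S)"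

end

theory Submission
  imports Defs
begin

text \<open>
  Write \<open>M\<close> for the set of exponents of the leading monomials of \<open>I\<close> with respect to a monomial order
  \<open>R\<close>, \<open>G\<close> for the reduced Groebner basis, and \<open>refine_by_weight \<omega> R\<close> for the order that compares
  \<open>\<omega>\<close>-weights first and breaks ties with \<open>R\<close>. Three facts give the theorem.

  \<^item> The Groebner cone of \<open>R\<close> consists of the weights \<open>\<omega> \<ge> 0\<close> for which no monomial of an element of \<open>G\<close>
    outweighs its leading monomial (\<open>groebner_cone_iff\<close>). The weights that meet these inequalities strictly
    are the ones whose initial ideal is that of \<open>R\<close>; every \<open>\<omega>\<close> that meets them weakly is a limit of
    those, since some weight \<open>v \<ge> 0\<close> meets all of them strictly and \<open>\<omega> + \<epsilon> v\<close> does so too.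
    In particular \<open>\<omega>\<close> lies in the cone of \<open>refine_by_weight \<omega> R\<close>, for every \<open>R\<close>.

  \<^item> \<open>R\<close> is an \<open>I\<close>-specific elimination order iff every monomial of \<open>K[X]\<close> that leads some element of \<open>I\<close>
    already leads an element of \<open>I \<inter> K[X]\<close> (\<open>specific_elim_order_iff\<close>). This criterion does not mention \<open>G\<close>
    and can therefore be carried from one order to another.

  \<^item> Refining \<open>R\<close> by a weight \<open>s\<close> of its own cone changes neither \<open>G\<close> nor its leading monomials, and hence
    preserves being an \<open>I\<close>-specific elimination order.

  Now let \<open>s\<close> lie in the cone of an \<open>I\<close>-specific elimination order \<open>R\<close>, let \<open>c \<ge> 0\<close> vanish on the \<open>x\<close>-variables,
  and let \<open>p = (1 - t) c + t s\<close>. Put \<open>R\<^sub>1 = refine_by_weight s R\<close> and \<open>R\<^sub>2 = refine_by_weight p R\<^sub>1\<close>. By the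
  first fact \<open>p\<close> lies in the cone of \<open>R\<^sub>2\<close>, and by the third \<open>R\<^sub>1\<close> is \<open>I\<close>-specific. It remains to see
  that \<open>R\<^sub>2\<close> is \<open>I\<close>-specific. Suppose \<open>f \<in> I\<close> has an \<open>R\<^sub>2\<close>-leading monomial \<open>y\<^sup>\<alpha>\<close> in \<open>K[X]\<close>. As \<open>c\<close> has value \<open>0\<close>
  on \<open>\<alpha>\<close> and is nonnegative elsewhere, each other monomial of \<open>f\<close> has smaller \<open>s\<close>-weight than \<open>y\<^sup>\<alpha>\<close> or, if its \<open>p\<close>-weight
  equals that of \<open>y\<^sup>\<alpha>\<close>, precedes \<open>y\<^sup>\<alpha>\<close> in \<open>R\<^sub>1\<close>; so \<open>y\<^sup>\<alpha>\<close> is also the \<open>R\<^sub>1\<close>-leading monomial of \<open>f\<close>. Hence it is the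
  \<open>R\<^sub>1\<close>-leading monomial of some \<open>h \<in> I \<inter> K[X]\<close>. Between monomials of \<open>K[X]\<close> the weight \<open>p\<close> is the multiple \<open>t s\<close> of
  \<open>s\<close>, so \<open>R\<^sub>1\<close> and \<open>R\<^sub>2\<close> agree there, and \<open>y\<^sup>\<alpha>\<close> is the \<open>R\<^sub>2\<close>-leading monomial of \<open>h\<close>.
  (\<open>specific_elim_order_refine_towards_center\<close>.)

  The inclusion of the centre is the case \<open>s = 0\<close>, \<open>t = 0\<close>, once some \<open>I\<close>-specific elimination order exists;
  comparing total degrees in the \<open>u\<close>-variables first gives one.
\<close>

abbreviation (input) "keys \<equiv> Poly_Mapping.keys"
abbreviation (input) "lookup \<equiv> Poly_Mapping.lookup"
abbreviation (input) "single \<equiv> Poly_Mapping.single"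

section \<open>Divisibility of monomials\<close>

definition expo_dvd :: "'v expo \<Rightarrow> 'v expo \<Rightarrow> bool" where
  "expo_dvd \<alpha> \<beta> \<longleftrightarrow> (\<exists>\<gamma>. \<beta> = \<alpha> + \<gamma>)"

lemma expo_dvd_iff_lookup: "expo_dvd \<alpha> \<beta> \<longleftrightarrow> (\<forall>i. lookup \<alpha> i \<le> lookup \<beta> i)"
proof
  assume "\<forall>i. lookup \<alpha> i \<le> lookup \<beta> i"
  then have "\<beta> = \<alpha> + (\<beta> - \<alpha>)"
    by (intro poly_mapping_eqI) (simp add: lookup_add lookup_minus)
  then show "expo_dvd \<alpha> \<beta>" unfolding expo_dvd_def by blast
qed (auto simp: expo_dvd_def lookup_add)

lemma expo_dvd_refl: "expo_dvd \<alpha> \<alpha>"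
  by (simp add: expo_dvd_iff_lookup)

lemma expo_dvd_trans: "expo_dvd \<alpha> \<beta> \<Longrightarrow> expo_dvd \<beta> \<gamma> \<Longrightarrow> expo_dvd \<alpha> \<gamma>"
  by (meson expo_dvd_iff_lookup order_trans)

text \<open>
  Dickson's lemma, coordinate by coordinate: a sequence of naturals has a monotone subsequence, and if that
  one decreases it is eventually constant.
\<close>

lemma monotone_subsequence_on_finite:
  fixes s :: "nat \<Rightarrow> 'v \<Rightarrow> nat"
  assumes "finite V"
  shows "\<exists>f. strict_mono f \<and> (\<forall>i\<in>V. incseq (\<lambda>n. s (f n) i))"
  using assms
proof (induction V rule: finite_induct)
  case empty
  show ?case by (rule exI[of _ id]) (auto simp: strict_mono_def)
next
  case (insert i V)
  then obtain f where f: "strict_mono f" "\<forall>i\<in>V. incseq (\<lambda>n. s (f n) i)" by blast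
  obtain g where g: "strict_mono g" "monoseq (\<lambda>n. s (f (g n)) i)"
    using seq_monosub[of "\<lambda>n. s (f n) i"] by blast
  have "\<exists>N. incseq (\<lambda>n. s (f (g (n + N))) i)"
  proof (cases "incseq (\<lambda>n. s (f (g n)) i)")
    case True
    then show ?thesis by (intro exI[of _ 0]) simp
  next
    case False
    then have dec: "decseq (\<lambda>n. s (f (g n)) i)" using g(2) monoseq_iff by blast
    \<comment> \<open>a decreasing sequence of naturals is constant from its minimum on\<close>
    obtain N where N: "\<And>n. s (f (g N)) i \<le> s (f (g n)) i"
      using ex_has_least_nat[of "\<lambda>_. True" undefined "\<lambda>n. s (f (g n)) i"] by auto
    have "s (f (g (n + N))) i = s (f (g N)) i" for n
      using N[of "n + N"] dec by (intro antisym) (auto simp: decseq_def)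
    then show ?thesis by (intro exI[of _ N]) (simp add: incseq_def)
  qed
  then obtain N where N: "incseq (\<lambda>n. s (f (g (n + N))) i)" by blast
  define h where "h n = f (g (n + N))" for n
  have "strict_mono h" unfolding h_def
    using f(1) g(1) by (auto simp: strict_mono_def)
  moreover have "incseq (\<lambda>n. s (h n) j)" if "j \<in> V" for j
  proof -
    have "incseq (\<lambda>n. s (f n) j)" using f(2) that by blast
    moreover have "mono (\<lambda>n. g (n + N))" using g(1)
      by (auto simp: strict_mono_less_eq mono_def)
    ultimately show ?thesis unfolding h_def by (simp add: mono_def)
  qed
  ultimately show ?case using N unfolding h_def by blast
qed

lemma dickson_sequence:
  fixes s :: "nat \<Rightarrow> ('v::finite) expo"
  obtains i j where "i < j" "expo_dvd (s i) (s j)"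
proof -
  obtain f where f: "strict_mono f" "\<forall>i. incseq (\<lambda>n. lookup (s (f n)) i)"
    using monotone_subsequence_on_finite[of UNIV "\<lambda>n. lookup (s n)"] by auto
  then have "expo_dvd (s (f 0)) (s (f 1))"
    by (auto simp: expo_dvd_iff_lookup incseq_def)
  moreover have "f 0 < f 1" using f(1) by (simp add: strict_mono_def)
  ultimately show ?thesis using that by blast
qed

definition minimal_expos :: "'v expo set \<Rightarrow> 'v expo set" where
  "minimal_expos M = {\<alpha>\<in>M. \<forall>\<beta>\<in>M. expo_dvd \<beta> \<alpha> \<longrightarrow> \<beta> = \<alpha>}"

lemma finite_minimal_expos: "finite (minimal_expos (M :: ('v::finite) expo set))"
proof (rule ccontr)
  assume "infinite (minimal_expos M)"
  then obtain s :: "nat \<Rightarrow> 'v expo" where s: "inj s" "range s \<subseteq> minimal_expos M"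
    using infinite_countable_subset by blast
  obtain i j where "i < j" "expo_dvd (s i) (s j)" by (rule dickson_sequence)
  moreover have "s i \<in> M" "s j \<in> minimal_expos M"
    using s(2) by (auto simp: minimal_expos_def)
  ultimately have "s i = s j" by (simp add: minimal_expos_def)
  then show False using s(1) \<open>i < j\<close> by (simp add: inj_eq)
qed

lemma minimal_expo_below:
  assumes "\<alpha> \<in> (M :: ('v::finite) expo set)"
  obtains \<mu> where "\<mu> \<in> minimal_expos M" "expo_dvd \<mu> \<alpha>"
proof -
  define size where "size \<beta> = (\<Sum>i\<in>UNIV. lookup \<beta> i)" for \<beta> :: "'v expo"
  obtain \<mu> where \<mu>: "\<mu> \<in> M" "expo_dvd \<mu> \<alpha>"
    and least: "\<And>\<beta>. \<beta> \<in> M \<Longrightarrow> expo_dvd \<beta> \<alpha> \<Longrightarrow> size \<mu> \<le> size \<beta>"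
    using ex_has_least_nat[of "\<lambda>\<beta>. \<beta> \<in> M \<and> expo_dvd \<beta> \<alpha>" \<alpha> size] assms expo_dvd_refl by metis
  have "\<beta> = \<mu>" if below: "\<beta> \<in> M" "expo_dvd \<beta> \<mu>" for \<beta>
  proof -
    obtain \<gamma> where \<gamma>: "\<mu> = \<beta> + \<gamma>" using below(2) unfolding expo_dvd_def by blast
    have "size \<mu> \<le> size \<beta>" using least below \<mu>(2) expo_dvd_trans by blast
    then have "size \<gamma> = 0" by (simp add: \<gamma> size_def lookup_add sum.distrib)
    then have "\<gamma> = 0" by (intro poly_mapping_eqI) (simp add: size_def)
    then show ?thesis using \<gamma> by simp
  qed
  then show ?thesis using \<mu> by (intro that[of \<mu>]) (auto simp: minimal_expos_def)
qed

section \<open>Monomial orders and leading exponents\<close>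

lemma monomial_orderD:
  assumes "monomial_order R"
  shows "trans R" "irrefl R" "(\<alpha>, \<beta>) \<in> R \<or> \<alpha> = \<beta> \<or> (\<beta>, \<alpha>) \<in> R"
    "\<alpha> \<noteq> 0 \<Longrightarrow> (0, \<alpha>) \<in> R" "(\<alpha>, \<beta>) \<in> R \<Longrightarrow> (\<alpha> + \<gamma>, \<beta> + \<gamma>) \<in> R"
  using assms by (auto simp: monomial_order_def strict_linear_order_on_def total_on_def)

lemma monomial_order_trans:
  "monomial_order R \<Longrightarrow> (\<alpha>, \<beta>) \<in> R \<Longrightarrow> (\<beta>, \<gamma>) \<in> R \<Longrightarrow> (\<alpha>, \<gamma>) \<in> R"
  using monomial_orderD(1) by (blast dest: transD)

lemma monomial_order_irrefl: "monomial_order R \<Longrightarrow> (\<alpha>, \<alpha>) \<notin> R"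
  using monomial_orderD(2) by (auto simp: irrefl_def)

lemma expo_dvd_imp_le:
  assumes "monomial_order R" "expo_dvd \<alpha> \<beta>" "\<alpha> \<noteq> \<beta>"
  shows "(\<alpha>, \<beta>) \<in> R"
proof -
  obtain \<gamma> where \<gamma>: "\<beta> = \<alpha> + \<gamma>" using assms(2) expo_dvd_def by blast
  then have "\<gamma> \<noteq> 0" using assms(3) by auto
  then have "(0 + \<alpha>, \<gamma> + \<alpha>) \<in> R" using assms(1) monomial_orderD(4,5) by blast
  then show ?thesis by (simp add: \<gamma> add.commute)
qed

text \<open>
  An infinite descent would contain, by Dickson's lemma, an exponent that divides a later and hence smaller one.
\<close>

lemma wf_monomial_order:
  assumes "monomial_order (R :: ('v::finite) expo rel)"
  shows "wf R"
proof (rule ccontr)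
  assume "\<not> wf R"
  then obtain s where s: "\<And>i. (s (Suc i), s i) \<in> R"
    by (auto simp: wf_iff_no_infinite_down_chain)
  have desc: "(s (i + Suc k), s i) \<in> R" for i k
    by (induction k) (use s monomial_order_trans[OF assms] in auto)
  obtain i j where ij: "i < j" "expo_dvd (s i) (s j)" by (rule dickson_sequence)
  then have "(s j, s i) \<in> R" using desc[of i "j - Suc i"] by simp
  moreover have "(s i, s j) \<in> R \<or> s i = s j" using expo_dvd_imp_le[OF assms ij(2)] by blast
  ultimately have "(s j, s j) \<in> R" using monomial_order_trans[OF assms] by auto
  then show False using monomial_order_irrefl[OF assms] by blast
qed

lemma sum_strict_mono_monomial_order:
  assumes "monomial_order R" "finite A" "A \<noteq> {}" "\<And>a. a \<in> A \<Longrightarrow> (f a, g a) \<in> R"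
  shows "(sum f A, sum g A) \<in> R"
  using assms(2-)
proof (induction A rule: finite_ne_induct)
  case (insert a A)
  have "(f a + sum f A, g a + sum f A) \<in> R"
    by (rule monomial_orderD(5)[OF assms(1)]) (simp add: insert.prems)
  moreover have "(sum f A + g a, sum g A + g a) \<in> R"
    by (rule monomial_orderD(5)[OF assms(1)]) (simp add: insert.IH insert.prems)
  then have "(g a + sum f A, g a + sum g A) \<in> R" by (simp only: add.commute)
  ultimately have "(f a + sum f A, g a + sum g A) \<in> R"
    by (rule monomial_order_trans[OF assms(1)])
  then show ?case using insert by simp
qed auto

lemma finite_has_greatest:
  assumes "monomial_order R" "finite A" "A \<noteq> {}"
  shows "\<exists>\<alpha>\<in>A. \<forall>\<beta>\<in>A. \<beta> \<noteq> \<alpha> \<longrightarrow> (\<beta>, \<alpha>) \<in> R"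
  using assms(2,3)
proof (induction A rule: finite_ne_induct)
  case (insert a A)
  then obtain \<alpha> where \<alpha>: "\<alpha> \<in> A" "\<forall>\<beta>\<in>A. \<beta> \<noteq> \<alpha> \<longrightarrow> (\<beta>, \<alpha>) \<in> R" by blast
  show ?case
  proof (cases "(a, \<alpha>) \<in> R")
    case False
    then have "a = \<alpha> \<or> (\<alpha>, a) \<in> R" using monomial_orderD(3)[OF assms(1)] by blast
    moreover have "(\<beta>, a) \<in> R" if "(\<alpha>, a) \<in> R" "\<beta> \<in> A" for \<beta>
      using \<alpha>(2) that monomial_order_trans[OF assms(1) _ that(1)] by (cases "\<beta> = \<alpha>") auto
    ultimately show ?thesis using \<alpha> by auto
  qed (use \<alpha> in auto)
qed auto

lemma lead_expo_eqI:
  assumes "monomial_order R" "\<alpha> \<in> keys f" "\<And>\<beta>. \<beta> \<in> keys f \<Longrightarrow> \<beta> \<noteq> \<alpha> \<Longrightarrow> (\<beta>, \<alpha>) \<in> R"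
  shows "lead_expo R f = \<alpha>"
  unfolding lead_expo_def
proof (rule the_equality)
  fix \<gamma> assume "\<gamma> \<in> keys f \<and> (\<forall>\<beta>\<in>keys f. \<beta> \<noteq> \<gamma> \<longrightarrow> (\<beta>, \<gamma>) \<in> R)"
  then show "\<gamma> = \<alpha>"
    using assms(2,3) monomial_order_trans[OF assms(1)] monomial_order_irrefl[OF assms(1)] by metis
qed (use assms in blast)

lemma lead_expo_greatest:
  assumes "monomial_order R" "f \<noteq> 0"
  shows lead_expo_in_keys: "lead_expo R f \<in> keys f"
    and below_lead_expo: "\<beta> \<in> keys f \<Longrightarrow> \<beta> \<noteq> lead_expo R f \<Longrightarrow> (\<beta>, lead_expo R f) \<in> R"
proof -
  have "keys f \<noteq> {}" using assms(2) by (simp)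
  then obtain \<alpha> where "\<alpha> \<in> keys f" "\<forall>\<beta>\<in>keys f. \<beta> \<noteq> \<alpha> \<longrightarrow> (\<beta>, \<alpha>) \<in> R"
    using finite_has_greatest[OF assms(1)] by (meson finite_keys)
  moreover from this have "lead_expo R f = \<alpha>" by (intro lead_expo_eqI assms) auto
  ultimately show "lead_expo R f \<in> keys f"
    "\<beta> \<in> keys f \<Longrightarrow> \<beta> \<noteq> lead_expo R f \<Longrightarrow> (\<beta>, lead_expo R f) \<in> R" by auto
qed

lemma lookup_single_mult:
  fixes f :: "('v, 'k::comm_ring_1) mpoly"
  shows "lookup (single \<gamma> c * f) (\<gamma> + \<beta>) = c * lookup f \<beta>"
proof -
  have "lookup (single \<gamma> c * f) (\<gamma> + \<beta>)
      = Sum_any (\<lambda>l. lookup (single \<gamma> c) l * Sum_any (\<lambda>q. lookup f q when \<gamma> + \<beta> = l + q))"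
    by (simp add: lookup_mult)
  also have "\<dots> = (\<Sum>l\<in>{\<gamma>}. lookup (single \<gamma> c) l * Sum_any (\<lambda>q. lookup f q when \<gamma> + \<beta> = l + q))"
    by (rule Sum_any.expand_superset) (auto simp: lookup_single when_def split: if_splits)
  finally show ?thesis by simp
qed

corollary lookup_const_mult:
  fixes f :: "('v, 'k::comm_ring_1) mpoly"
  shows "lookup (single 0 c * f) \<beta> = c * lookup f \<beta>"
  using lookup_single_mult[of 0 c f \<beta>] by simp

lemma keys_single_mult:
  fixes f :: "('v, 'k::field) mpoly"
  assumes "c \<noteq> 0"
  shows "keys (single \<gamma> c * f) = (+) \<gamma> ` keys f"
proof
  show "keys (single \<gamma> c * f) \<subseteq> (+) \<gamma> ` keys f"
    using keys_mult[of "single \<gamma> c" f] assms by auto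
  show "(+) \<gamma> ` keys f \<subseteq> keys (single \<gamma> c * f)"
    using assms by (auto simp: in_keys_iff lookup_single_mult)
qed

lemma lead_expo_single_mult:
  fixes f :: "('v, 'k::field) mpoly"
  assumes "monomial_order R" "f \<noteq> 0" "c \<noteq> 0"
  shows "lead_expo R (single \<gamma> c * f) = \<gamma> + lead_expo R f"
  using lead_expo_greatest[OF assms(1,2)] monomial_orderD(5)[OF assms(1)]
  by (intro lead_expo_eqI assms(1)) (auto simp: keys_single_mult[OF assms(3)] add.commute[of \<gamma>])

text \<open>
  Turns the divisibility condition in the definition of a reduced basis into one on exponents; the coefficient
  of the leading term is a unit.
\<close>

lemma lead_term_dvd_iff:
  fixes f :: "('v, 'k::field) mpoly"
  assumes "monomial_order R" "f \<noteq> 0"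
  shows "lead_term R f dvd single \<beta> 1 \<longleftrightarrow> expo_dvd (lead_expo R f) \<beta>"
proof -
  let ?c = "lookup f (lead_expo R f)"
  have c: "?c \<noteq> 0" using lead_expo_in_keys[OF assms] by (simp add: in_keys_iff)
  show ?thesis
  proof
    assume "lead_term R f dvd single \<beta> 1"
    then obtain h where "single \<beta> 1 = single (lead_expo R f) ?c * h"
      by (auto simp: lead_term_def leading_coeff_def elim: dvdE)
    then have "{\<beta>} = (+) (lead_expo R f) ` keys h"
      using keys_single_mult[OF c] by (metis keys_single zero_neq_one)
    then show "expo_dvd (lead_expo R f) \<beta>" unfolding expo_dvd_def by blast
  next
    assume "expo_dvd (lead_expo R f) \<beta>"
    then obtain \<gamma> where "\<beta> = lead_expo R f + \<gamma>" unfolding expo_dvd_def by blast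
    then have "single \<beta> 1 = lead_term R f * single \<gamma> (1 / ?c)"
      using c by (simp add: lead_term_def leading_coeff_def mult_single)
    then show "lead_term R f dvd single \<beta> 1" by (rule dvdI)
  qed
qed

section \<open>Initial ideals as sets of exponents\<close>

text \<open>
  The initial ideal of \<open>I\<close> is a monomial ideal, so this set of exponents determines it (\<open>lead_ideal_eq\<close>). Inclusions
  and equalities of initial ideals are handled as inclusions and equalities of such sets.
\<close>

definition lead_expos :: "'v expo rel \<Rightarrow> ('v, 'k::zero) mpoly set \<Rightarrow> 'v expo set" where
  "lead_expos R I = lead_expo R ` (I - {0})"

lemma lead_exposI: "f \<in> I \<Longrightarrow> f \<noteq> 0 \<Longrightarrow> lead_expo R f \<in> lead_expos R I"
  by (simp add: lead_expos_def)

lemma poly_eq_sum_single: "(\<Sum>\<alpha>\<in>keys f. single \<alpha> (lookup f \<alpha>)) = f"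
proof (rule poly_mapping_eqI)
  fix \<beta>
  have "lookup (\<Sum>\<alpha>\<in>keys f. single \<alpha> (lookup f \<alpha>)) \<beta> = (\<Sum>\<alpha>\<in>keys f. if \<alpha> = \<beta> then lookup f \<alpha> else 0)"
    by (simp add: lookup_sum lookup_single when_def)
  then show "lookup (\<Sum>\<alpha>\<in>keys f. single \<alpha> (lookup f \<alpha>)) \<beta> = lookup f \<beta>"
    by (simp add: in_keys_iff)
qed

lemma keys_diff_subset:
  fixes f g :: "('v, 'k::ab_group_add) mpoly"
  shows "keys (f - g) \<subseteq> keys f \<union> keys g"
  by (auto simp: in_keys_iff lookup_minus)

lemma subspace_keys_subset:
  fixes E :: "'v expo set"
  assumes "\<And>\<alpha> \<gamma>. \<alpha> \<in> E \<Longrightarrow> \<alpha> + \<gamma> \<in> E"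
  shows "ideal.subspace {f :: ('v, 'k::field) mpoly. keys f \<subseteq> E}"
proof (rule ideal.subspaceI)
  fix f g :: "('v, 'k) mpoly"
  assume "f \<in> {f. keys f \<subseteq> E}" "g \<in> {f. keys f \<subseteq> E}"
  then show "f + g \<in> {f. keys f \<subseteq> E}" using keys_add[of f g] by auto
next
  fix c f :: "('v, 'k) mpoly"
  assume "f \<in> {f. keys f \<subseteq> E}"
  moreover have "\<gamma> + \<alpha> \<in> E" if "\<alpha> \<in> E" for \<alpha> \<gamma>
    using assms[OF that, of \<gamma>] by (simp add: add.commute[of \<gamma>])
  ultimately show "c * f \<in> {f. keys f \<subseteq> E}" using keys_mult[of c f] by blast
qed simp

lemma span_lead_terms:
  fixes F :: "('v, 'k::field) mpoly set"
  assumes R: "monomial_order R" and "0 \<notin> F"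
  shows "ideal.span (lead_term R ` F) = {f. \<forall>\<beta>\<in>keys f. \<exists>g\<in>F. expo_dvd (lead_expo R g) \<beta>}"
    (is "_ = {f. \<forall>\<beta>\<in>keys f. ?E \<beta>}")
proof
  have "?E (\<alpha> + \<gamma>)" if "?E \<alpha>" for \<alpha> \<gamma>
    using that expo_dvd_trans expo_dvd_def by blast
  then have "ideal.subspace {f :: ('v, 'k) mpoly. keys f \<subseteq> Collect ?E}"
    by (intro subspace_keys_subset) auto
  moreover have "lead_term R ` F \<subseteq> {f. keys f \<subseteq> Collect ?E}"
    using expo_dvd_refl by (fastforce simp: lead_term_def split: if_splits)
  ultimately have "ideal.span (lead_term R ` F) \<subseteq> {f. keys f \<subseteq> Collect ?E}"
    by (rule ideal.span_minimal[rotated])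
  then show "ideal.span (lead_term R ` F) \<subseteq> {f. \<forall>\<beta>\<in>keys f. ?E \<beta>}" by auto
next
  show "{f. \<forall>\<beta>\<in>keys f. ?E \<beta>} \<subseteq> ideal.span (lead_term R ` F)"
  proof
    fix f :: "('v, 'k) mpoly"
    assume f: "f \<in> {f. \<forall>\<beta>\<in>keys f. ?E \<beta>}"
    have "single \<beta> (lookup f \<beta>) \<in> ideal.span (lead_term R ` F)" if "\<beta> \<in> keys f" for \<beta>
    proof -
      obtain g where g: "g \<in> F" "expo_dvd (lead_expo R g) \<beta>" using f \<open>\<beta> \<in> keys f\<close> by auto
      then have "lead_term R g dvd single \<beta> 1"
        using lead_term_dvd_iff[OF R, of g] assms(2) by auto
      then obtain k where k: "single \<beta> 1 = lead_term R g * k" by (elim dvdE)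
      have "single \<beta> (lookup f \<beta>) = single 0 (lookup f \<beta>) * single \<beta> 1" by (simp add: mult_single)
      also have "\<dots> = (single 0 (lookup f \<beta>) * k) * lead_term R g" by (simp only: k mult_ac)
      also have "\<dots> \<in> ideal.span (lead_term R ` F)"
        using g by (intro ideal.span_scale ideal.span_base) auto
      finally show ?thesis .
    qed
    then have "(\<Sum>\<beta>\<in>keys f. single \<beta> (lookup f \<beta>)) \<in> ideal.span (lead_term R ` F)"
      by (rule ideal.span_sum)
    then show "f \<in> ideal.span (lead_term R ` F)" by (simp only: poly_eq_sum_single)
  qed
qed

lemma lead_expos_closed_under_multiples:
  fixes I :: "('v, 'k::field) mpoly set"
  assumes "ideal.subspace I" "monomial_order R" "\<alpha> \<in> lead_expos R I" "expo_dvd \<alpha> \<beta>"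
  shows "\<beta> \<in> lead_expos R I"
proof -
  obtain f where f: "f \<in> I" "f \<noteq> 0" "\<alpha> = lead_expo R f" using assms(3) by (auto simp: lead_expos_def)
  obtain \<gamma> where \<gamma>: "\<beta> = \<alpha> + \<gamma>" using assms(4) by (auto simp: expo_dvd_def)
  have "keys (single \<gamma> 1 * f) \<noteq> {}" using f by (simp add: keys_single_mult)
  then have "single \<gamma> 1 * f \<noteq> 0" by auto
  moreover have "single \<gamma> 1 * f \<in> I" using assms(1) f(1) by (rule ideal.subspace_scale)
  moreover have "lead_expo R (single \<gamma> 1 * f) = \<beta>"
    using lead_expo_single_mult[OF assms(2) f(2)] by (simp add: \<gamma> f add.commute)
  ultimately show ?thesis using lead_exposI by blast
qed

lemma lead_ideal_eq:
  fixes I :: "('v, 'k::field) mpoly set"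
  assumes "ideal.subspace I" "monomial_order R"
  shows "lead_ideal R I = {f. keys f \<subseteq> lead_expos R I}"
proof -
  have "lead_ideal R I = ideal.span (lead_term R ` (I - {0}))"
    unfolding lead_ideal_def by (rule arg_cong[where f = ideal.span]) auto
  also have "\<dots> = {f. \<forall>\<beta>\<in>keys f. \<exists>g\<in>I - {0}. expo_dvd (lead_expo R g) \<beta>}"
    by (rule span_lead_terms[OF assms(2)]) simp
  also have "\<dots> = {f. \<forall>\<beta>\<in>keys f. \<beta> \<in> lead_expos R I}"
  proof -
    have "(\<exists>g\<in>I - {0}. expo_dvd (lead_expo R g) \<beta>) \<longleftrightarrow> \<beta> \<in> lead_expos R I" for \<beta>
      using lead_expos_closed_under_multiples[OF assms] lead_exposI expo_dvd_refl
      unfolding lead_expos_def by fast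
    then show ?thesis by simp
  qed
  finally show ?thesis by auto
qed

section \<open>Normal forms\<close>

text \<open>
  The division algorithm, as induction along the well-founded order. The set \<open>A\<close> serves to keep the remainder
  within the span of given monomials: if the reductions of monomials in \<open>A\<close> can be done by elements of \<open>I\<close> supported in \<open>A\<close>,
  the remainder of a polynomial supported in \<open>A\<close> is supported in \<open>A\<close>. With \<open>A\<close> the exponents of \<open>K[X]\<close> this is what
  moves an element of the reduced Groebner basis into \<open>K[X]\<close>.
\<close>

lemma reduce_modulo_ideal:
  fixes I :: "('v::finite, 'k::field) mpoly set"
  assumes I: "ideal.subspace I" and R: "monomial_order R"
    and A: "\<And>\<beta>. \<beta> \<in> lead_expos R I \<inter> A \<Longrightarrow> \<exists>h\<in>I. h \<noteq> 0 \<and> keys h \<subseteq> A \<and> lead_expo R h = \<beta>"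
    and "keys f \<subseteq> A" "\<And>\<beta>. \<beta> \<in> keys f \<Longrightarrow> (\<beta>, \<alpha>) \<in> R"
  obtains r where "f - r \<in> I" "keys r \<subseteq> A - lead_expos R I" "\<And>\<beta>. \<beta> \<in> keys r \<Longrightarrow> (\<beta>, \<alpha>) \<in> R"
proof -
  have "\<exists>r. f - r \<in> I \<and> keys r \<subseteq> A - lead_expos R I \<and> (\<forall>\<beta>\<in>keys r. (\<beta>, \<alpha>) \<in> R)"
    using assms(4,5)
  proof (induction \<alpha> arbitrary: f rule: wf_induct_rule[OF wf_monomial_order[OF R]])
    case (1 \<alpha>)
    show ?case
    proof (cases "f = 0")
      case True
      then show ?thesis using ideal.subspace_0[OF I] by (intro exI[of _ 0]) simp
    next
      case False
      define \<beta> where "\<beta> = lead_expo R f"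
      have \<beta>: "\<beta> \<in> keys f" unfolding \<beta>_def by (rule lead_expo_in_keys[OF R False])
      have below: "(\<delta>, \<beta>) \<in> R" if "\<delta> \<in> keys f" "\<delta> \<noteq> \<beta>" for \<delta>
        using below_lead_expo[OF R False] that unfolding \<beta>_def by blast
      have \<beta>\<alpha>: "(\<beta>, \<alpha>) \<in> R" using 1(3) \<beta> by blast
      have trans: "(\<delta>, \<alpha>) \<in> R" if "(\<delta>, \<beta>) \<in> R" for \<delta>
        using that \<beta>\<alpha> by (rule monomial_order_trans[OF R])
      let ?c = "lookup f \<beta>"
      show ?thesis
      proof (cases "\<beta> \<in> lead_expos R I")
        case False
        define f' where "f' = f - single \<beta> ?c"
        have f': "keys f' \<subseteq> keys f - {\<beta>}"
          by (auto simp: f'_def in_keys_iff lookup_minus lookup_single when_def split: if_splits)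
        then obtain r where r: "f' - r \<in> I" "keys r \<subseteq> A - lead_expos R I" "\<forall>\<delta>\<in>keys r. (\<delta>, \<beta>) \<in> R"
          using 1(1)[OF \<beta>\<alpha>, of f'] 1(2) below by blast
        have "f - (r + single \<beta> ?c) \<in> I" using r(1) by (simp add: f'_def algebra_simps)
        moreover have "keys (r + single \<beta> ?c) \<subseteq> insert \<beta> (keys r)"
          using keys_add[of r "single \<beta> ?c"] by (auto split: if_splits)
        ultimately show ?thesis
          using r(2,3) trans \<beta>\<alpha> False \<beta> 1(2) by (intro exI[of _ "r + single \<beta> ?c"]) blast
      next
        case True
        then obtain h where h: "h \<in> I" "h \<noteq> 0" "keys h \<subseteq> A" "lead_expo R h = \<beta>"
          using A \<beta> 1(2) by blast
        define e :: "('v, 'k) mpoly" where "e = single 0 (?c / lookup h \<beta>)"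
        have lookup_eh: "lookup (e * h) \<delta> = ?c / lookup h \<beta> * lookup h \<delta>" for \<delta>
          by (simp add: e_def lookup_const_mult)
        have "lookup h \<beta> \<noteq> 0" using lead_expo_in_keys[OF R h(2)] h(4) by (simp add: in_keys_iff)
        then have "lookup (f - e * h) \<beta> = 0" by (simp add: lookup_minus lookup_eh)
        then have "keys (f - e * h) \<subseteq> (keys f \<union> keys h) - {\<beta>}"
          by (auto simp: in_keys_iff lookup_minus lookup_eh)
        then have "keys (f - e * h) \<subseteq> A" "\<And>\<delta>. \<delta> \<in> keys (f - e * h) \<Longrightarrow> (\<delta>, \<beta>) \<in> R"
          using below below_lead_expo[OF R h(2)] h(3,4) 1(2) by blast+
        then obtain r where r: "f - e * h - r \<in> I" "keys r \<subseteq> A - lead_expos R I" "\<forall>\<delta>\<in>keys r. (\<delta>, \<beta>) \<in> R"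
          using 1(1)[OF \<beta>\<alpha>, of "f - e * h"] by blast
        have "(f - e * h - r) + e * h \<in> I"
          by (intro ideal.subspace_add[OF I] r(1) ideal.subspace_scale[OF I] h(1))
        then have "f - r \<in> I" by (simp add: algebra_simps)
        then show ?thesis using r(2,3) trans by blast
      qed
    qed
  qed
  then show ?thesis using that by blast
qed

text \<open>
  Take an element of \<open>I\<close> with leading exponent \<open>\<alpha>\<close>, make it monic, and replace its tail by the normal form
  of the tail.
\<close>

lemma exists_reduced_element:
  fixes I :: "('v::finite, 'k::field) mpoly set"
  assumes I: "ideal.subspace I" and R: "monomial_order R"
    and A: "\<And>\<beta>. \<beta> \<in> lead_expos R I \<inter> A \<Longrightarrow> \<exists>h\<in>I. h \<noteq> 0 \<and> keys h \<subseteq> A \<and> lead_expo R h = \<beta>"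
    and \<alpha>: "\<alpha> \<in> lead_expos R I \<inter> A"
  obtains g where "g \<in> I" "keys g \<subseteq> A" "lookup g \<alpha> = 1" "keys g \<inter> lead_expos R I = {\<alpha>}"
proof -
  obtain h where h: "h \<in> I" "h \<noteq> 0" "keys h \<subseteq> A" "lead_expo R h = \<alpha>" using A[OF \<alpha>] by blast
  have hne: "lookup h \<alpha> \<noteq> 0" using lead_expo_in_keys[OF R h(2)] h(4) by (simp add: in_keys_iff)
  define e :: "('v, 'k) mpoly" where "e = single 0 (1 / lookup h \<alpha>)"
  have lookup_eh: "lookup (e * h) \<delta> = 1 / lookup h \<alpha> * lookup h \<delta>" for \<delta>
    by (simp add: e_def lookup_const_mult)
  define f where "f = e * h - single \<alpha> 1"
  have "keys f \<subseteq> keys h - {\<alpha>}"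
    using hne by (auto simp: f_def in_keys_iff lookup_minus lookup_eh lookup_single when_def split: if_splits)
  then have "keys f \<subseteq> A" "\<And>\<beta>. \<beta> \<in> keys f \<Longrightarrow> (\<beta>, \<alpha>) \<in> R"
    using h(3,4) below_lead_expo[OF R h(2)] by blast+
  then obtain r where r: "f - r \<in> I" "keys r \<subseteq> A - lead_expos R I" "\<And>\<beta>. \<beta> \<in> keys r \<Longrightarrow> (\<beta>, \<alpha>) \<in> R"
    using reduce_modulo_ideal[OF I R A, of f \<alpha>] by blast
  define g where "g = single \<alpha> 1 + r"
  have "e * h - (f - r) \<in> I"
    by (intro ideal.subspace_diff[OF I] r(1) ideal.subspace_scale[OF I] h(1))
  then have "g \<in> I" by (simp add: g_def f_def algebra_simps)
  moreover have "\<alpha> \<notin> keys r" using r(2) \<alpha> by blast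
  then have g\<alpha>: "lookup g \<alpha> = 1" by (simp add: g_def lookup_add in_keys_iff)
  moreover have keys_g: "keys g \<subseteq> insert \<alpha> (keys r)"
    using keys_add[of "single \<alpha> 1" r] by (auto simp: g_def split: if_splits)
  moreover have "\<alpha> \<in> keys g" using g\<alpha> by (simp add: in_keys_iff)
  ultimately show ?thesis using that[of g] r(2) \<alpha> by blast
qed

corollary exists_reduced_element_at_lead_expo:
  fixes I :: "('v::finite, 'k::field) mpoly set"
  assumes "ideal.subspace I" "monomial_order R" "\<alpha> \<in> lead_expos R I"
  obtains g where "g \<in> I" "lookup g \<alpha> = 1" "keys g \<inter> lead_expos R I = {\<alpha>}"
proof -
  have lead: "\<exists>h\<in>I. h \<noteq> 0 \<and> keys h \<subseteq> UNIV \<and> lead_expo R h = \<beta>" if "\<beta> \<in> lead_expos R I \<inter> UNIV" for \<beta>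
    using that by (auto simp: lead_expos_def)
  show ?thesis
    by (rule exists_reduced_element[OF assms(1,2) lead]) (use assms(3) that in simp_all)
qed

lemma zero_if_no_key_in_lead_expos:
  assumes "monomial_order R" "f \<in> I" "keys f \<inter> lead_expos R I = {}"
  shows "f = 0"
  using lead_expo_in_keys[OF assms(1)] lead_exposI[OF assms(2)] assms(3) by blast

lemma lead_expo_eq_if_only_key:
  assumes "monomial_order R" "f \<in> I" "keys f \<inter> lead_expos R I = {\<alpha>}"
  shows "f \<noteq> 0" "lead_expo R f = \<alpha>"
proof -
  show "f \<noteq> 0" using assms(3) by auto
  then show "lead_expo R f = \<alpha>"
    using lead_expo_in_keys[OF assms(1)] lead_exposI[OF assms(2)] assms(3) by blast
qed

text \<open>
  The difference lies in \<open>I\<close>, but none of its monomials can be a leading one.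
\<close>

lemma reduced_element_unique:
  fixes I :: "('v, 'k::field) mpoly set"
  assumes I: "ideal.subspace I" and R: "monomial_order R"
    and "f \<in> I" "lookup f \<alpha> = 1" "keys f \<inter> lead_expos R I = {\<alpha>}"
    and "g \<in> I" "lookup g \<alpha> = 1" "keys g \<inter> lead_expos R I = {\<alpha>}"
  shows "f = g"
proof -
  have "\<alpha> \<notin> keys (f - g)" using assms by (simp add: in_keys_iff lookup_minus)
  then have "keys (f - g) \<inter> lead_expos R I = {}"
    using keys_diff_subset[of f g] assms(5,8) by fastforce
  moreover have "f - g \<in> I" using I assms(3,6) by (rule ideal.subspace_diff)
  ultimately show ?thesis using zero_if_no_key_in_lead_expos[OF R] by fastforce
qed

section \<open>The reduced Groebner basis\<close>

text \<open>
  With \<open>M\<close> the leading exponents of \<open>I\<close>, these are the monomials \<open>y\<^sup>\<alpha>\<close>, for the minimal generators \<open>\<alpha>\<close> of \<open>M\<close>,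
  minus their normal forms. The order enters only through \<open>M\<close>, so that orders with the same initial ideal visibly
  have the same reduced Groebner basis.
\<close>

definition reduced_elements :: "'v expo set \<Rightarrow> ('v, 'k::field) mpoly set \<Rightarrow> ('v, 'k) mpoly set" where
  "reduced_elements M I = {g\<in>I. \<exists>\<alpha>\<in>minimal_expos M. lookup g \<alpha> = 1 \<and> keys g \<inter> M = {\<alpha>}}"

lemma reduced_elementsD:
  assumes "g \<in> reduced_elements (lead_expos R I) I" "monomial_order R"
  shows "g \<in> I" "g \<noteq> 0" "lead_expo R g \<in> minimal_expos (lead_expos R I)"
    "lookup g (lead_expo R g) = 1" "keys g \<inter> lead_expos R I = {lead_expo R g}"
    "lead_expo R g \<in> lead_expos R I"
proof -
  obtain \<alpha> where \<alpha>: "g \<in> I" "\<alpha> \<in> minimal_expos (lead_expos R I)" "lookup g \<alpha> = 1"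
      "keys g \<inter> lead_expos R I = {\<alpha>}"
    using assms(1) unfolding reduced_elements_def by blast
  then show "g \<in> I" "g \<noteq> 0" "lead_expo R g \<in> minimal_expos (lead_expos R I)"
    "lookup g (lead_expo R g) = 1" "keys g \<inter> lead_expos R I = {lead_expo R g}"
    "lead_expo R g \<in> lead_expos R I"
    using lead_expo_eq_if_only_key[OF assms(2) \<alpha>(1,4)] by (auto simp: minimal_expos_def)
qed

lemma reduced_elements_lead_all:
  fixes I :: "('v::finite, 'k::field) mpoly set"
  assumes I: "ideal.subspace I" and R: "monomial_order R" and \<alpha>: "\<alpha> \<in> lead_expos R I"
  obtains g where "g \<in> reduced_elements (lead_expos R I) I" "expo_dvd (lead_expo R g) \<alpha>"
proof -
  obtain \<mu> where \<mu>: "\<mu> \<in> minimal_expos (lead_expos R I)" "expo_dvd \<mu> \<alpha>"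
    using minimal_expo_below[OF \<alpha>] by blast
  have "\<mu> \<in> lead_expos R I" using \<mu>(1) by (simp add: minimal_expos_def)
  then obtain g where g: "g \<in> I" "lookup g \<mu> = 1" "keys g \<inter> lead_expos R I = {\<mu>}"
    using exists_reduced_element_at_lead_expo[OF I R] by blast
  then have "g \<in> reduced_elements (lead_expos R I) I" using \<mu>(1) unfolding reduced_elements_def by blast
  moreover have "lead_expo R g = \<mu>" using lead_expo_eq_if_only_key[OF R] g by blast
  ultimately show ?thesis using that \<mu>(2) by blast
qed

lemma groebner_basis_iff:
  fixes I :: "('v, 'k::field) mpoly set"
  assumes I: "ideal.subspace I" and R: "monomial_order R"
  shows "groebner_basis R I G \<longleftrightarrow> finite G \<and> G \<subseteq> I \<and> 0 \<notin> G \<and>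
    (\<forall>\<alpha>\<in>lead_expos R I. \<exists>g\<in>G. expo_dvd (lead_expo R g) \<alpha>)"
proof -
  have "ideal.span (lead_term R ` G) = lead_ideal R I
      \<longleftrightarrow> (\<forall>\<alpha>\<in>lead_expos R I. \<exists>g\<in>G. expo_dvd (lead_expo R g) \<alpha>)" (is "_ \<longleftrightarrow> ?r")
    if G: "G \<subseteq> I" "0 \<notin> G"
  proof
    assume eq: "ideal.span (lead_term R ` G) = lead_ideal R I"
    have "single \<alpha> 1 \<in> lead_ideal R I" if "\<alpha> \<in> lead_expos R I" for \<alpha>
      using that by (simp add: lead_ideal_eq[OF I R])
    then show ?r unfolding eq[symmetric] span_lead_terms[OF R G(2)] by fastforce
  next
    assume ?r
    moreover have "\<beta> \<in> lead_expos R I" if "g \<in> G" "expo_dvd (lead_expo R g) \<beta>" for g \<beta>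
      using that lead_expos_closed_under_multiples[OF I R] lead_exposI[of g I R] G by blast
    ultimately show "ideal.span (lead_term R ` G) = lead_ideal R I"
      unfolding lead_ideal_eq[OF I R] span_lead_terms[OF R G(2)] by blast
  qed
  then show ?thesis unfolding groebner_basis_def by blast
qed

lemma reduced_elements_reduced_GB:
  fixes I :: "('v::finite, 'k::field) mpoly set"
  assumes I: "ideal.subspace I" and R: "monomial_order R"
  defines "G \<equiv> reduced_elements (lead_expos R I) I"
  shows "groebner_basis R I G \<and> reduced_basis R G \<and> normed_basis R G"
proof (intro conjI)
  have "inj_on (lead_expo R) G"
  proof (rule inj_onI)
    fix g h assume "g \<in> G" "h \<in> G" and eq: "lead_expo R g = lead_expo R h"
    then have "g \<in> reduced_elements (lead_expos R I) I" "h \<in> reduced_elements (lead_expos R I) I"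
      unfolding G_def by auto
    note g = reduced_elementsD[OF this(1) R] and h = reduced_elementsD[OF this(2) R]
    show "g = h" by (rule reduced_element_unique[OF I R g(1,4,5)]) (use h eq in auto)
  qed
  moreover have "lead_expo R ` G \<subseteq> minimal_expos (lead_expos R I)"
    unfolding G_def using reduced_elementsD(3)[OF _ R] by blast
  ultimately have "finite G" using finite_minimal_expos by (metis inj_on_finite)
  then show "groebner_basis R I G"
    unfolding groebner_basis_iff[OF I R]
  proof (intro conjI ballI)
    show "G \<subseteq> I" "0 \<notin> G" unfolding G_def using reduced_elementsD(1,2)[OF _ R] by auto
    show "\<exists>g\<in>G. expo_dvd (lead_expo R g) \<alpha>" if "\<alpha> \<in> lead_expos R I" for \<alpha>
      using reduced_elements_lead_all[OF I R that] unfolding G_def by blast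
  qed
  show "normed_basis R G"
    unfolding normed_basis_def leading_coeff_def G_def using reduced_elementsD(4)[OF _ R] by blast
  show "reduced_basis R G"
    unfolding reduced_basis_def
  proof (intro ballI impI notI)
    fix g h \<beta>
    assume gh: "g \<in> G" "h \<in> G" "g \<noteq> h" "\<beta> \<in> keys h" and dvd: "lead_term R g dvd single \<beta> 1"
    note g = reduced_elementsD[OF gh(1)[unfolded G_def] R]
    note h = reduced_elementsD[OF gh(2)[unfolded G_def] R]
    have dvd': "expo_dvd (lead_expo R g) \<beta>" using dvd lead_term_dvd_iff[OF R g(2)] by simp
    note gM = g(6)
    then have "\<beta> \<in> lead_expos R I"
      using dvd' lead_expos_closed_under_multiples[OF I R] by blast
    then have "\<beta> = lead_expo R h" using h(5) gh(4) by blast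
    then have "lead_expo R g = lead_expo R h"
      using h(3) gM dvd' unfolding minimal_expos_def by blast
    then show False using \<open>inj_on (lead_expo R) G\<close> gh(1-3) by (meson inj_onD)
  qed
qed

text \<open>
  Reducedness excludes every element whose leading exponent is not minimal in \<open>M\<close> and every further monomial with
  exponent in \<open>M\<close>: such a monomial would be divisible by the leading monomial of another element of \<open>G\<close>.
\<close>

lemma reduced_GB_unique:
  fixes I :: "('v::finite, 'k::field) mpoly set"
  assumes I: "ideal.subspace I" and R: "monomial_order R"
    and GB: "groebner_basis R I G" "reduced_basis R G" "normed_basis R G"
  shows "G = reduced_elements (lead_expos R I) I"
proof
  let ?M = "lead_expos R I"
  have G: "G \<subseteq> I" "0 \<notin> G" and cover: "\<And>\<alpha>. \<alpha> \<in> ?M \<Longrightarrow> \<exists>g\<in>G. expo_dvd (lead_expo R g) \<alpha>"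
    using GB(1) unfolding groebner_basis_iff[OF I R] by auto
  have red: "\<not> expo_dvd (lead_expo R g) \<beta>" if "g \<in> G" "h \<in> G" "g \<noteq> h" "\<beta> \<in> keys h" for g h \<beta>
    using GB(2) that lead_term_dvd_iff[OF R] G(2) unfolding reduced_basis_def by metis
  show "G \<subseteq> reduced_elements ?M I"
  proof
    fix g assume g: "g \<in> G"
    then have gI: "g \<in> I" "g \<noteq> 0" using G by auto
    let ?\<alpha> = "lead_expo R g"
    have \<alpha>: "?\<alpha> \<in> ?M" "?\<alpha> \<in> keys g" using lead_exposI gI lead_expo_in_keys[OF R] by auto
    have only: "\<beta> = ?\<alpha>" if \<beta>: "\<beta> \<in> keys g" "\<beta> \<in> ?M" for \<beta>
    proof (rule ccontr)
      assume ne: "\<beta> \<noteq> ?\<alpha>"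
      obtain h where h: "h \<in> G" "expo_dvd (lead_expo R h) \<beta>" using cover \<beta>(2) by blast
      have "h = g" using red[OF h(1) g _ \<beta>(1)] h(2) by blast
      then have "(?\<alpha>, \<beta>) \<in> R" using expo_dvd_imp_le[OF R h(2)] ne by auto
      moreover have "(\<beta>, ?\<alpha>) \<in> R" using below_lead_expo[OF R gI(2) \<beta>(1) ne] .
      ultimately have "(\<beta>, \<beta>) \<in> R" by (rule monomial_order_trans[OF R, rotated])
      then show False using monomial_order_irrefl[OF R] by blast
    qed
    have "\<beta> = ?\<alpha>" if \<beta>: "\<beta> \<in> ?M" "expo_dvd \<beta> ?\<alpha>" for \<beta>
    proof (rule ccontr)
      assume ne: "\<beta> \<noteq> ?\<alpha>"
      obtain h where h: "h \<in> G" "expo_dvd (lead_expo R h) \<beta>" using cover \<beta>(1) by blast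
      have "h = g" using red[OF h(1) g _ \<alpha>(2)] expo_dvd_trans[OF h(2) \<beta>(2)] by blast
      then have "(?\<alpha>, \<beta>) \<in> R" using expo_dvd_imp_le[OF R h(2)] ne by auto
      moreover have "(\<beta>, ?\<alpha>) \<in> R" using expo_dvd_imp_le[OF R \<beta>(2)] ne .
      ultimately have "(\<beta>, \<beta>) \<in> R" by (rule monomial_order_trans[OF R, rotated])
      then show False using monomial_order_irrefl[OF R] by blast
    qed
    then have "?\<alpha> \<in> minimal_expos ?M" using \<alpha>(1) unfolding minimal_expos_def by blast
    moreover have "lookup g ?\<alpha> = 1" using GB(3) g by (simp add: normed_basis_def leading_coeff_def)
    moreover have "keys g \<inter> ?M = {?\<alpha>}" using only \<alpha> by blast
    ultimately show "g \<in> reduced_elements ?M I" using gI unfolding reduced_elements_def by blast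
  qed
  show "reduced_elements ?M I \<subseteq> G"
  proof
    fix h assume h: "h \<in> reduced_elements ?M I"
    note hD = reduced_elementsD[OF h R]
    obtain g where g: "g \<in> G" "expo_dvd (lead_expo R g) (lead_expo R h)" using cover hD(6) by blast
    have gE: "g \<in> reduced_elements ?M I" using g(1) \<open>G \<subseteq> reduced_elements ?M I\<close> by blast
    note gD = reduced_elementsD[OF gE R]
    have eq: "lead_expo R g = lead_expo R h"
      using g(2) gD(6) hD(3) unfolding minimal_expos_def by blast
    have "g = h"
      by (rule reduced_element_unique[OF I R gD(1,4,5)]) (use hD eq in auto)
    then show "h \<in> G" using g(1) by simp
  qed
qed

lemma reduced_GB_eq:
  fixes I :: "('v::finite, 'k::field) mpoly set"
  assumes "ideal.subspace I" "monomial_order R"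
  shows "reduced_GB R I = reduced_elements (lead_expos R I) I"
  unfolding reduced_GB_def
  using reduced_elements_reduced_GB[OF assms] reduced_GB_unique[OF assms]
  by (intro the_equality) auto

text \<open>
  A reduced element for \<open>R'\<close> at \<open>\<alpha>\<close> has no other monomial in the larger set than \<open>y\<^sup>\<alpha>\<close>, so \<open>y\<^sup>\<alpha>\<close> is its only
  possible leading monomial for \<open>R\<close>.
\<close>

lemma lead_expos_subset_imp_eq:
  fixes I :: "('v::finite, 'k::field) mpoly set"
  assumes I: "ideal.subspace I" and R: "monomial_order R" and R': "monomial_order R'"
    and sub: "lead_expos R I \<subseteq> lead_expos R' I"
  shows "lead_expos R I = lead_expos R' I"
proof
  show "lead_expos R' I \<subseteq> lead_expos R I"
  proof
    fix \<alpha> assume "\<alpha> \<in> lead_expos R' I"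
    then obtain g where g: "g \<in> I" "keys g \<inter> lead_expos R' I = {\<alpha>}"
      using exists_reduced_element_at_lead_expo[OF I R'] by blast
    then have "g \<noteq> 0" by auto
    then have "lead_expo R g \<in> keys g \<inter> lead_expos R' I"
      using lead_expo_in_keys[OF R] lead_exposI[OF g(1)] sub by blast
    then have "lead_expo R g = \<alpha>" using g(2) by blast
    then show "\<alpha> \<in> lead_expos R I" using lead_exposI[OF g(1) \<open>g \<noteq> 0\<close>] by blast
  qed
qed (fact sub)

lemma lead_expos_eq_if_same_leads_on_GB:
  fixes I :: "('v::finite, 'k::field) mpoly set"
  assumes I: "ideal.subspace I" and R: "monomial_order R" and R': "monomial_order R'"
    and leads: "\<And>g. g \<in> reduced_GB R I \<Longrightarrow> lead_expo R' g = lead_expo R g"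
  shows "lead_expos R' I = lead_expos R I"
proof (rule lead_expos_subset_imp_eq[OF I R R', symmetric])
  show "lead_expos R I \<subseteq> lead_expos R' I"
  proof
    fix \<alpha> assume "\<alpha> \<in> lead_expos R I"
    then obtain g where g: "g \<in> reduced_elements (lead_expos R I) I" "expo_dvd (lead_expo R g) \<alpha>"
      by (rule reduced_elements_lead_all[OF I R])
    have "lead_expo R' g = lead_expo R g" using leads g(1) by (simp add: reduced_GB_eq[OF I R])
    moreover have "lead_expo R' g \<in> lead_expos R' I"
      using lead_exposI reduced_elementsD(1,2)[OF g(1) R] by blast
    ultimately show "\<alpha> \<in> lead_expos R' I"
      using lead_expos_closed_under_multiples[OF I R'] g(2) by simp
  qed
qed

section \<open>Ideal-specific elimination orders\<close>

definition expos_without :: "'v set \<Rightarrow> 'v expo set" where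
  "expos_without U = {\<alpha>. keys \<alpha> \<inter> U = {}}"

lemma polys_without_iff: "f \<in> polys_without U \<longleftrightarrow> keys f \<subseteq> expos_without U"
  by (auto simp: polys_without_def expos_without_def)

lemma expos_without_add: "\<alpha> + \<beta> \<in> expos_without U \<longleftrightarrow> \<alpha> \<in> expos_without U \<and> \<beta> \<in> expos_without U"
  by (auto simp: expos_without_def disjoint_iff in_keys_iff lookup_add)

text \<open>
  From left to right, a suitable multiple of an element of the basis is the required \<open>h\<close>. From right to left,
  normal forms of polynomials in \<open>K[X]\<close> can be computed within \<open>K[X]\<close>, and by uniqueness the basis element
  arises in this way.
\<close>

lemma specific_elim_order_iff:
  fixes I :: "('v::finite, 'k::field) mpoly set"
  assumes I: "ideal.subspace I" and R: "monomial_order R"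
  shows "specific_elim_order U I R \<longleftrightarrow>
    (\<forall>\<alpha>\<in>lead_expos R I \<inter> expos_without U.
       \<exists>h\<in>I. h \<noteq> 0 \<and> keys h \<subseteq> expos_without U \<and> lead_expo R h = \<alpha>)" (is "_ = ?elim")
proof -
  let ?M = "lead_expos R I" and ?X = "expos_without U"
  have lt: "lead_term R g \<in> polys_without U \<longleftrightarrow> lead_expo R g \<in> ?X"
    if "g \<in> reduced_elements ?M I" for g
    using reduced_elementsD(4)[OF that R]
    by (simp add: polys_without_iff lead_term_def leading_coeff_def)
  have spec: "specific_elim_order U I R \<longleftrightarrow>
      (\<forall>g\<in>reduced_elements ?M I. lead_expo R g \<in> ?X \<longrightarrow> keys g \<subseteq> ?X)"
    using lt by (auto simp: specific_elim_order_def R reduced_GB_eq[OF I R] polys_without_iff)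
  show ?thesis
  proof
    assume s: "specific_elim_order U I R"
    show ?elim
    proof
      fix \<alpha> assume \<alpha>: "\<alpha> \<in> ?M \<inter> ?X"
      then obtain g where g: "g \<in> reduced_elements ?M I" "expo_dvd (lead_expo R g) \<alpha>"
        using reduced_elements_lead_all[OF I R] by blast
      obtain \<gamma> where \<gamma>: "\<alpha> = lead_expo R g + \<gamma>" using g(2) by (auto simp: expo_dvd_def)
      have X: "lead_expo R g \<in> ?X" "\<gamma> \<in> ?X" using \<alpha> by (simp_all add: \<gamma> expos_without_add)
      note gD = reduced_elementsD[OF g(1) R]
      have "keys g \<subseteq> ?X" using s spec g(1) X(1) by blast
      then have "keys (single \<gamma> 1 * g) \<subseteq> ?X"
        using X(2) by (auto simp: keys_single_mult expos_without_add)
      moreover have "single \<gamma> 1 * g \<in> I" using I gD(1) by (rule ideal.subspace_scale)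
      moreover have "keys (single \<gamma> 1 * g) \<noteq> {}" using gD(2) by (simp add: keys_single_mult)
      then have "single \<gamma> 1 * g \<noteq> 0" by auto
      moreover have "lead_expo R (single \<gamma> 1 * g) = \<alpha>"
        using lead_expo_single_mult[OF R gD(2)] by (simp add: \<gamma> add.commute)
      ultimately show "\<exists>h\<in>I. h \<noteq> 0 \<and> keys h \<subseteq> ?X \<and> lead_expo R h = \<alpha>" by blast
    qed
  next
    assume e: ?elim
    show "specific_elim_order U I R"
      unfolding spec
    proof (intro ballI impI)
      fix g assume g: "g \<in> reduced_elements ?M I" "lead_expo R g \<in> ?X"
      note gD = reduced_elementsD[OF g(1) R]
      have lead: "lead_expo R g \<in> ?M \<inter> ?X" using gD(6) g(2) by blast
      obtain g' where g': "g' \<in> I" "keys g' \<subseteq> ?X" "lookup g' (lead_expo R g) = 1"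
          "keys g' \<inter> ?M = {lead_expo R g}"
        by (rule exists_reduced_element[OF I R bspec[OF e] lead])
      have "g = g'" by (rule reduced_element_unique[OF I R gD(1,4,5) g'(1,3,4)])
      then show "keys g \<subseteq> ?X" using g'(2) by simp
    qed
  qed
qed

lemma specific_elim_order_if_same_leads_on_GB:
  fixes I :: "('v::finite, 'k::field) mpoly set"
  assumes I: "ideal.subspace I" and R: "specific_elim_order U I R" and R': "monomial_order R'"
    and leads: "\<And>g. g \<in> reduced_GB R I \<Longrightarrow> lead_expo R' g = lead_expo R g"
  shows "specific_elim_order U I R'"
proof -
  have mo: "monomial_order R" using R by (simp add: specific_elim_order_def)
  have "reduced_GB R' I = reduced_GB R I"
    using lead_expos_eq_if_same_leads_on_GB[OF I mo R' leads]
    by (simp add: reduced_GB_eq[OF I mo] reduced_GB_eq[OF I R'])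
  then show ?thesis
    using R R' leads by (simp add: specific_elim_order_def lead_term_def leading_coeff_def)
qed

section \<open>Weights\<close>

lemma weight_add: "weight \<omega> (\<alpha> + \<beta>) = weight \<omega> \<alpha> + weight \<omega> \<beta>"
  by (simp add: weight_def inner_vec_def lookup_add distrib_left sum.distrib)

lemma weight_zero: "weight \<omega> 0 = 0"
  by (simp add: weight_def inner_vec_def)

lemma weight_single: "weight \<omega> (single i 1) = \<omega> $ i"
proof -
  have "weight \<omega> (single i 1) = (\<Sum>j\<in>UNIV. if i = j then \<omega> $ j else 0)"
    unfolding weight_def inner_vec_def by (rule sum.cong) (auto simp: lookup_single when_def)
  then show ?thesis by simp
qed

lemma weight_nonneg: "\<omega> \<in> nonneg_weights \<Longrightarrow> 0 \<le> weight \<omega> \<alpha>"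
  by (auto simp: weight_def inner_vec_def nonneg_weights_def intro!: sum_nonneg)

lemma weight_add_left: "weight (u + v) \<alpha> = weight u \<alpha> + weight v \<alpha>"
  by (simp add: weight_def inner_add_left)

lemma weight_scaleR_left: "weight (t *\<^sub>R v) \<alpha> = t * weight v \<alpha>"
  by (simp add: weight_def)

lemma weight_eq_zero:
  assumes "\<alpha> \<in> expos_without U" "\<forall>i. i \<notin> U \<longrightarrow> \<omega> $ i = 0"
  shows "weight \<omega> \<alpha> = 0"
proof -
  have "\<omega> $ i * real (lookup \<alpha> i) = 0" for i
    using assms by (cases "i \<in> U") (auto simp: expos_without_def in_keys_iff disjoint_iff)
  then have "(\<Sum>i\<in>UNIV. \<omega> $ i * real (lookup \<alpha> i)) = 0" by (intro sum.neutral) blast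
  then show ?thesis by (simp add: weight_def inner_vec_def)
qed

definition refine_by_weight :: "real ^ 'v::finite \<Rightarrow> 'v expo rel \<Rightarrow> 'v expo rel" where
  "refine_by_weight \<omega> R =
     {(\<alpha>, \<beta>). weight \<omega> \<alpha> < weight \<omega> \<beta> \<or> weight \<omega> \<alpha> = weight \<omega> \<beta> \<and> (\<alpha>, \<beta>) \<in> R}"

lemma refine_by_weight_iff:
  "(\<alpha>, \<beta>) \<in> refine_by_weight \<omega> R \<longleftrightarrow>
     weight \<omega> \<alpha> < weight \<omega> \<beta> \<or> weight \<omega> \<alpha> = weight \<omega> \<beta> \<and> (\<alpha>, \<beta>) \<in> R"
  by (simp add: refine_by_weight_def)

lemma monomial_order_refine_by_weight:
  assumes R: "monomial_order R" and \<omega>: "\<omega> \<in> nonneg_weights"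
  shows "monomial_order (refine_by_weight \<omega> R)"
proof -
  have "trans (refine_by_weight \<omega> R)"
  proof (rule transI)
    fix \<alpha> \<beta> \<gamma>
    assume "(\<alpha>, \<beta>) \<in> refine_by_weight \<omega> R" "(\<beta>, \<gamma>) \<in> refine_by_weight \<omega> R"
    then show "(\<alpha>, \<gamma>) \<in> refine_by_weight \<omega> R"
      using monomial_order_trans[OF R, of \<alpha> \<beta> \<gamma>] by (auto simp: refine_by_weight_iff)
  qed
  moreover have "irrefl (refine_by_weight \<omega> R)"
    using monomial_order_irrefl[OF R] by (auto simp: irrefl_def refine_by_weight_iff)
  moreover have "total (refine_by_weight \<omega> R)"
    using monomial_orderD(3)[OF R] by (fastforce simp: total_on_def refine_by_weight_iff)
  moreover have "(0, \<alpha>) \<in> refine_by_weight \<omega> R" if "\<alpha> \<noteq> 0" for \<alpha>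
    using weight_nonneg[OF \<omega>, of \<alpha>] monomial_orderD(4)[OF R that]
    by (auto simp: refine_by_weight_iff weight_zero)
  moreover have "(\<alpha> + \<gamma>, \<beta> + \<gamma>) \<in> refine_by_weight \<omega> R" if "(\<alpha>, \<beta>) \<in> refine_by_weight \<omega> R" for \<alpha> \<beta> \<gamma>
    using that monomial_orderD(5)[OF R, of \<alpha> \<beta> \<gamma>] by (auto simp: refine_by_weight_iff weight_add)
  ultimately show ?thesis
    by (auto simp: monomial_order_def strict_linear_order_on_def)
qed

lemma lookup_wlead_form:
  "lookup (wlead_form \<omega> f) \<beta> = (if \<beta> \<in> keys f \<and> weight \<omega> \<beta> = wdeg \<omega> f then lookup f \<beta> else 0)"
proof -
  let ?T = "{\<alpha>. \<alpha> \<in> keys f \<and> weight \<omega> \<alpha> = wdeg \<omega> f}"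
  have "finite ?T" by (rule finite_subset[of _ "keys f"]) auto
  moreover have "lookup (wlead_form \<omega> f) \<beta> = (\<Sum>\<alpha>\<in>?T. if \<alpha> = \<beta> then lookup f \<alpha> else 0)"
    by (simp add: wlead_form_def lookup_sum lookup_single when_def)
  ultimately show ?thesis by simp
qed

lemma keys_wlead_form: "keys (wlead_form \<omega> f) = {\<beta> \<in> keys f. weight \<omega> \<beta> = wdeg \<omega> f}"
  by (auto simp: in_keys_iff lookup_wlead_form split: if_splits)

lemma weight_le_wdeg: "\<beta> \<in> keys f \<Longrightarrow> weight \<omega> \<beta> \<le> wdeg \<omega> f"
  by (simp add: wdeg_def)

lemma wlead_form_eq_single:
  assumes "\<alpha> \<in> keys f" "\<And>\<beta>. \<beta> \<in> keys f \<Longrightarrow> \<beta> \<noteq> \<alpha> \<Longrightarrow> weight \<omega> \<beta> < weight \<omega> \<alpha>"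
  shows "wlead_form \<omega> f = single \<alpha> (lookup f \<alpha>)"
proof -
  have "wdeg \<omega> f = weight \<omega> \<alpha>"
    unfolding wdeg_def by (rule Max_eqI) (use assms in \<open>auto intro: less_imp_le\<close>)
  then show ?thesis
    using assms by (intro poly_mapping_eqI) (force simp: lookup_wlead_form lookup_single when_def)
qed

section \<open>Groebner cones in terms of the reduced Groebner basis\<close>

text \<open>
  All monomials of the leading form of \<open>g\<close> lie in the initial ideal, and the leading one is the only such
  monomial of the reduced element \<open>g\<close>.
\<close>

lemma wlead_ideal_eq_lead_ideal_imp_strict:
  fixes I :: "('v::finite, 'k::field) mpoly set"
  assumes I: "ideal.subspace I" and R: "monomial_order R"
    and eq: "wlead_ideal \<omega> I = lead_ideal R I"
    and g: "g \<in> reduced_GB R I" and \<beta>: "\<beta> \<in> keys g" "\<beta> \<noteq> lead_expo R g"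
  shows "weight \<omega> \<beta> < weight \<omega> (lead_expo R g)"
proof -
  note gD = reduced_elementsD[OF g[unfolded reduced_GB_eq[OF I R]] R]
  have "wlead_form \<omega> g \<in> wlead_ideal \<omega> I"
    unfolding wlead_ideal_def using gD(1,2) by (intro ideal.span_base) blast
  then have "keys (wlead_form \<omega> g) \<subseteq> lead_expos R I"
    by (simp add: eq lead_ideal_eq[OF I R])
  then have only: "\<gamma> = lead_expo R g" if "\<gamma> \<in> keys g" "weight \<omega> \<gamma> = wdeg \<omega> g" for \<gamma>
    using gD(5) that unfolding keys_wlead_form by blast
  have "wdeg \<omega> g \<in> weight \<omega> ` keys g"
    unfolding wdeg_def using \<beta>(1) by (intro Max_in) auto
  then have "weight \<omega> (lead_expo R g) = wdeg \<omega> g" using only by fastforce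
  moreover have "weight \<omega> \<beta> \<le> wdeg \<omega> g" "weight \<omega> \<beta> \<noteq> wdeg \<omega> g"
    using weight_le_wdeg \<beta> only by blast+
  ultimately show ?thesis by simp
qed

text \<open>
  The order \<open>R' = refine_by_weight \<omega> R\<close> has the same leading exponents as \<open>R\<close>, because it selects the same leading
  monomials on the basis. Suppose that the leading form of some \<open>f \<in> I\<close> has a monomial outside the initial ideal.
  Cancel all its other monomials by multiples of basis elements; by strictness their tails have smaller weight.
  This leaves an element of \<open>I\<close> whose top-weight monomials all lie outside the initial ideal, among them
  its \<open>R'\<close>-leading one, which is a contradiction.
\<close>

lemma strict_imp_wlead_ideal_eq_lead_ideal:
  fixes I :: "('v::finite, 'k::field) mpoly set"
  assumes I: "ideal.subspace I" and R: "monomial_order R" and \<omega>: "\<omega> \<in> nonneg_weights"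
    and strict: "\<And>g \<beta>. g \<in> reduced_GB R I \<Longrightarrow> \<beta> \<in> keys g \<Longrightarrow> \<beta> \<noteq> lead_expo R g \<Longrightarrow>
      weight \<omega> \<beta> < weight \<omega> (lead_expo R g)"
  shows "wlead_ideal \<omega> I = lead_ideal R I"
proof -
  let ?M = "lead_expos R I"
  define R' where "R' = refine_by_weight \<omega> R"
  have R': "monomial_order R'"
    unfolding R'_def using R \<omega> by (rule monomial_order_refine_by_weight)
  have M: "lead_expos R' I = ?M"
  proof (rule lead_expos_eq_if_same_leads_on_GB[OF I R R'])
    fix g assume g: "g \<in> reduced_GB R I"
    note gD = reduced_elementsD[OF g[unfolded reduced_GB_eq[OF I R]] R]
    show "lead_expo R' g = lead_expo R g"
      using strict[OF g] lead_expo_in_keys[OF R gD(2)]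
      by (intro lead_expo_eqI[OF R']) (auto simp: R'_def refine_by_weight_iff)
  qed
  have "\<exists>h\<in>I. lookup h \<alpha> = 1 \<and> (\<forall>\<beta>\<in>keys h. \<beta> \<noteq> \<alpha> \<longrightarrow> weight \<omega> \<beta> < weight \<omega> \<alpha>)"
    if \<alpha>: "\<alpha> \<in> ?M" for \<alpha>
  proof -
    obtain g where g: "g \<in> reduced_elements ?M I" "expo_dvd (lead_expo R g) \<alpha>"
      using reduced_elements_lead_all[OF I R \<alpha>] by blast
    note gD = reduced_elementsD[OF g(1) R]
    obtain \<gamma> where \<gamma>: "\<alpha> = lead_expo R g + \<gamma>" using g(2) by (auto simp: expo_dvd_def)
    have "lookup (single \<gamma> 1 * g) \<alpha> = 1"
      using lookup_single_mult[of \<gamma> 1 g "lead_expo R g"] gD(4) by (simp add: \<gamma> add.commute)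
    moreover have "weight \<omega> \<beta> < weight \<omega> \<alpha>" if \<beta>: "\<beta> \<in> keys (single \<gamma> 1 * g)" "\<beta> \<noteq> \<alpha>" for \<beta>
    proof -
      obtain \<delta> where \<delta>: "\<beta> = \<gamma> + \<delta>" "\<delta> \<in> keys g"
        using \<beta>(1) by (auto simp: keys_single_mult)
      then have "\<delta> \<noteq> lead_expo R g" using \<beta>(2) \<gamma> by (auto simp: add.commute)
      then have "weight \<omega> \<delta> < weight \<omega> (lead_expo R g)"
        using strict \<delta>(2) g(1) by (simp add: reduced_GB_eq[OF I R])
      then show ?thesis by (simp add: \<delta>(1) \<gamma> weight_add)
    qed
    moreover have "single \<gamma> 1 * g \<in> I" using I gD(1) by (rule ideal.subspace_scale)
    ultimately show ?thesis by blast
  qed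
  then obtain h where h: "\<And>\<alpha>. \<alpha> \<in> ?M \<Longrightarrow> h \<alpha> \<in> I" "\<And>\<alpha>. \<alpha> \<in> ?M \<Longrightarrow> lookup (h \<alpha>) \<alpha> = 1"
      "\<And>\<alpha> \<beta>. \<alpha> \<in> ?M \<Longrightarrow> \<beta> \<in> keys (h \<alpha>) \<Longrightarrow> \<beta> \<noteq> \<alpha> \<Longrightarrow> weight \<omega> \<beta> < weight \<omega> \<alpha>"
    by metis
  have "lead_ideal R I \<subseteq> wlead_ideal \<omega> I"
  proof
    fix f assume "f \<in> lead_ideal R I"
    then have f: "keys f \<subseteq> ?M" by (simp add: lead_ideal_eq[OF I R])
    have "single \<alpha> (lookup f \<alpha>) \<in> wlead_ideal \<omega> I" if "\<alpha> \<in> keys f" for \<alpha>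
    proof -
      have \<alpha>: "\<alpha> \<in> ?M" using f that by blast
      have key: "\<alpha> \<in> keys (h \<alpha>)" using h(2)[OF \<alpha>] by (simp add: in_keys_iff)
      then have "h \<alpha> \<noteq> 0" by auto
      moreover have "wlead_form \<omega> (h \<alpha>) = single \<alpha> 1"
        using wlead_form_eq_single[OF key h(3)[OF \<alpha>]] h(2)[OF \<alpha>] by simp
      ultimately have "single \<alpha> 1 \<in> {wlead_form \<omega> f | f. f \<in> I \<and> f \<noteq> 0}"
        using h(1)[OF \<alpha>] by (smt (verit) mem_Collect_eq)
      then have "single 0 (lookup f \<alpha>) * single \<alpha> 1 \<in> wlead_ideal \<omega> I"
        unfolding wlead_ideal_def by (intro ideal.span_scale ideal.span_base)
      then show ?thesis by (simp add: mult_single)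
    qed
    then have "(\<Sum>\<alpha>\<in>keys f. single \<alpha> (lookup f \<alpha>)) \<in> wlead_ideal \<omega> I"
      unfolding wlead_ideal_def by (rule ideal.span_sum)
    then show "f \<in> wlead_ideal \<omega> I" by (simp only: poly_eq_sum_single)
  qed
  moreover have "keys (wlead_form \<omega> f) \<subseteq> ?M" if f: "f \<in> I" for f
  proof (rule subsetI, rule ccontr)
    let ?d = "wdeg \<omega> f"
    let ?B = "keys (wlead_form \<omega> f) \<inter> ?M"
    fix \<beta> assume \<beta>: "\<beta> \<in> keys (wlead_form \<omega> f)" "\<beta> \<notin> ?M"
    \<comment> \<open>\<open>h \<alpha>\<close> has leading form \<open>y\<^sup>\<alpha>\<close>, so in weight \<open>?d\<close> just the monomials of \<open>f\<close> outside \<open>?M\<close> survive in \<open>F\<close>.\<close>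
    define F where "F = f - (\<Sum>\<alpha>\<in>?B. single 0 (lookup f \<alpha>) * h \<alpha>)"
    have "F \<in> I"
      unfolding F_def
      by (intro ideal.subspace_diff[OF I] f ideal.subspace_sum[OF I] ideal.subspace_scale[OF I] h(1)) blast
    have lookup_F: "lookup F \<gamma> = lookup f \<gamma> - (\<Sum>\<alpha>\<in>?B. lookup f \<alpha> * lookup (h \<alpha>) \<gamma>)" for \<gamma>
      by (simp add: F_def lookup_minus lookup_sum lookup_const_mult)
    have lookup_h: "lookup (h \<alpha>) \<gamma> = (if \<alpha> = \<gamma> then 1 else 0)"
      if "\<alpha> \<in> ?B" "?d \<le> weight \<omega> \<gamma>" for \<alpha> \<gamma>
    proof -
      have "\<alpha> \<in> ?M" "weight \<omega> \<alpha> = ?d" using that(1) by (auto simp: keys_wlead_form)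
      then show ?thesis using h(2)[of \<alpha>] h(3)[of \<alpha> \<gamma>] that(2) by (force simp: in_keys_iff)
    qed
    have top: "lookup F \<gamma> = lookup f \<gamma> - (if \<gamma> \<in> ?B then lookup f \<gamma> else 0)" if "?d \<le> weight \<omega> \<gamma>" for \<gamma>
    proof -
      have "(\<Sum>\<alpha>\<in>?B. lookup f \<alpha> * lookup (h \<alpha>) \<gamma>) = (\<Sum>\<alpha>\<in>?B. if \<alpha> = \<gamma> then lookup f \<alpha> else 0)"
        by (rule sum.cong) (auto simp: lookup_h that)
      then show ?thesis by (simp add: lookup_F)
    qed
    have "weight \<omega> \<beta> = ?d" "lookup f \<beta> \<noteq> 0" using \<beta>(1) by (auto simp: keys_wlead_form in_keys_iff)
    then have \<beta>F: "\<beta> \<in> keys F" using top[of \<beta>] \<beta>(2) by (simp add: in_keys_iff)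
    then have "F \<noteq> 0" by auto
    let ?\<nu> = "lead_expo R' F"
    have \<lambda>: "?\<nu> \<in> keys F" "?\<nu> \<in> ?M"
      using lead_expo_in_keys[OF R' \<open>F \<noteq> 0\<close>] lead_exposI[OF \<open>F \<in> I\<close> \<open>F \<noteq> 0\<close>, of R'] M by auto
    have "weight \<omega> \<beta> \<le> weight \<omega> ?\<nu>"
      using below_lead_expo[OF R' \<open>F \<noteq> 0\<close> \<beta>F] by (cases "\<beta> = ?\<nu>") (auto simp: R'_def refine_by_weight_iff)
    then have d: "?d \<le> weight \<omega> ?\<nu>" using \<open>weight \<omega> \<beta> = ?d\<close> by simp
    then have "?\<nu> \<in> keys f" "?\<nu> \<notin> ?B" using top[OF d] \<lambda>(1) by (auto simp: in_keys_iff split: if_splits)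
    then show False using \<lambda>(2) d weight_le_wdeg[of ?\<nu> f \<omega>] by (simp add: keys_wlead_form)
  qed
  then have "{wlead_form \<omega> f | f. f \<in> I \<and> f \<noteq> 0} \<subseteq> {f. keys f \<subseteq> ?M}" by auto
  then have "wlead_ideal \<omega> I \<subseteq> {f. keys f \<subseteq> ?M}"
    unfolding wlead_ideal_def
  proof (rule ideal.span_minimal)
    show "ideal.subspace {f :: ('v, 'k) mpoly. keys f \<subseteq> ?M}"
      using lead_expos_closed_under_multiples[OF I R]
      by (intro subspace_keys_subset) (auto simp: expo_dvd_def)
  qed
  ultimately show ?thesis by (auto simp: lead_ideal_eq[OF I R])
qed

section \<open>Weights that realise finitely many comparisons\<close>

text \<open>
  If no such weight exists, separation of convex sets shows that \<open>0\<close> is a convex combination of the difference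
  vectors \<open>\<alpha> - \<beta>\<close> of the comparisons. The differences are integer vectors, so simultaneous Diophantine approximation of
  the coefficients turns it into a nontrivial combination with natural coefficients: the combination of the
  approximations is an integer vector of size less than \<open>1\<close>, hence zero. Adding up the corresponding
  comparisons \<open>\<beta> < \<alpha>\<close> then gives one of a monomial with itself.
\<close>

lemma exists_weight_realising_comparisons:
  fixes R :: "('v::finite) expo rel"
  assumes R: "monomial_order R" and "finite P" and P: "P \<subseteq> R"
  obtains v where "v \<in> nonneg_weights" "\<And>\<beta> \<alpha>. (\<beta>, \<alpha>) \<in> P \<Longrightarrow> weight v \<beta> < weight v \<alpha>"
proof -
  \<comment> \<open>Comparing \<open>1\<close> with each variable forces the weight to be positive in every coordinate.\<close>
  define Q where "Q = P \<union> range (\<lambda>i. (0, single i (1::nat)))"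
  have "finite Q" unfolding Q_def using \<open>finite P\<close> by simp
  have "single i (1::nat) \<noteq> 0" for i :: 'v
    by (metis lookup_single_eq lookup_zero zero_neq_one)
  then have "Q \<subseteq> R" unfolding Q_def using P monomial_orderD(4)[OF R] by auto
  define \<delta> :: "'v expo \<times> 'v expo \<Rightarrow> real ^ 'v" where
    "\<delta> q = (\<chi> i. real (lookup (snd q) i) - real (lookup (fst q) i))" for q
  have weight_\<delta>: "v \<bullet> \<delta> q = weight v (snd q) - weight v (fst q)" for v q
    by (simp add: weight_def inner_vec_def \<delta>_def right_diff_distrib sum_subtractf)
  have "0 \<notin> convex hull (\<delta> ` Q)"
  proof
    assume "0 \<in> convex hull (\<delta> ` Q)"
    then obtain u where u: "\<And>d. d \<in> \<delta> ` Q \<Longrightarrow> 0 \<le> u d" "sum u (\<delta> ` Q) = 1"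
        "(\<Sum>d\<in>\<delta> ` Q. u d *\<^sub>R d) = 0"
      using convex_hull_finite[of "\<delta> ` Q"] \<open>finite Q\<close> by auto
    define n where "n = card (\<delta> ` Q)"
    obtain e where e: "bij_betw e {..<n} (\<delta> ` Q)"
      using ex_bij_betw_nat_finite[of "\<delta> ` Q"] \<open>finite Q\<close> by (auto simp: n_def atLeast0LessThan)
    have "\<exists>q\<in>Q. \<delta> q = e i" if "i < n" for i using bij_betwE[OF e] that by (metis imageE lessThan_iff)
    then obtain q where q: "\<And>i. i < n \<Longrightarrow> q i \<in> Q" "\<And>i. i < n \<Longrightarrow> \<delta> (q i) = e i" by metis
    define \<theta> where "\<theta> i = u (e i)" for i
    have \<theta>: "\<And>i. i < n \<Longrightarrow> 0 \<le> \<theta> i" "(\<Sum>i<n. \<theta> i) = 1" "(\<Sum>i<n. \<theta> i *\<^sub>R e i) = 0"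
      using u bij_betwE[OF e] sum.reindex_bij_betw[OF e, of u]
        sum.reindex_bij_betw[OF e, of "\<lambda>d. u d *\<^sub>R d"] by (auto simp: \<theta>_def)
    define S where "S = (\<Sum>i<n. \<Sum>k\<in>UNIV. \<bar>e i $ k\<bar>)"
    have "0 \<le> S" unfolding S_def by (intro sum_nonneg) auto
    \<comment> \<open>Errors below \<open>1 / N\<close> must neither move the combination by \<open>1\<close> nor destroy that the coefficients sum to at least \<open>1\<close>.\<close>
    obtain N :: nat where N: "real n + S + 1 < real N" using reals_Archimedean2 by blast
    have "0 < N" using N \<open>0 \<le> S\<close> by (cases N) auto
    obtain m :: int and p :: "nat \<Rightarrow> int" where "0 < m"
      and p: "\<And>i. i < n \<Longrightarrow> \<bar>of_int m * \<theta> i - of_int (p i)\<bar> < 1 / N"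
      by (rule Dirichlet_approx_simult[OF \<open>0 < N\<close>, of n \<theta>]) blast
    have p_nonneg: "0 \<le> p i" if "i < n" for i
    proof -
      have "0 \<le> of_int m * \<theta> i" using \<open>0 < m\<close> \<theta>(1) that by simp
      moreover have "1 / real N \<le> 1" using \<open>0 < N\<close> by simp
      ultimately have "- 1 < real_of_int (p i)" using p[OF that] by linarith
      then show ?thesis by linarith
    qed
    have cancel: "(\<Sum>i<n. of_int (p i) * e i $ k) = 0" for k
    proof -
      have "(\<Sum>i<n. \<theta> i * e i $ k) = 0"
        using arg_cong[OF \<theta>(3), of "\<lambda>x. x $ k"] by simp
      moreover have "(\<Sum>i<n. (of_int (p i) - of_int m * \<theta> i) * e i $ k)
          = (\<Sum>i<n. of_int (p i) * e i $ k) - of_int m * (\<Sum>i<n. \<theta> i * e i $ k)"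
        by (simp only: left_diff_distrib sum_subtractf sum_distrib_left mult.assoc)
      ultimately have "(\<Sum>i<n. of_int (p i) * e i $ k) = (\<Sum>i<n. (of_int (p i) - of_int m * \<theta> i) * e i $ k)"
        by (simp only: mult_zero_right diff_zero)
      also have "\<bar>\<dots>\<bar> \<le> (\<Sum>i<n. 1 / N * \<bar>e i $ k\<bar>)"
      proof (intro order_trans[OF sum_abs] sum_mono)
        fix i assume "i \<in> {..<n}"
        then have "\<bar>of_int (p i) - of_int m * \<theta> i\<bar> \<le> 1 / N" using p[of i] by (simp add: abs_minus_commute)
        then show "\<bar>(of_int (p i) - of_int m * \<theta> i) * e i $ k\<bar> \<le> 1 / N * \<bar>e i $ k\<bar>"
          unfolding abs_mult by (rule mult_right_mono) simp
      qed
      also have "\<dots> \<le> 1 / N * S"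
        unfolding S_def sum_distrib_left[symmetric]
        by (intro mult_left_mono sum_mono member_le_sum) auto
      also have "\<dots> < 1" using N \<open>0 < N\<close> by (simp add: field_simps)
      finally have less: "\<bar>\<Sum>i<n. of_int (p i) * e i $ k\<bar> < 1" .
      have "(\<Sum>i<n. of_int (p i) * e i $ k)
          = of_int (\<Sum>i<n. p i * (int (lookup (snd (q i)) k) - int (lookup (fst (q i)) k)))"
        by (auto simp: q(2)[symmetric] \<delta>_def intro!: sum.cong)
      with less show ?thesis by (simp del: of_int_sum)
    qed
    have "0 < (\<Sum>i<n. p i)"
    proof -
      have "real_of_int m - real n / N = (\<Sum>i<n. of_int m * \<theta> i - 1 / N)"
        by (simp add: sum_subtractf \<theta>(2) flip: sum_distrib_left)
      also have "\<dots> \<le> (\<Sum>i<n. of_int (p i))"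
      proof (rule sum_mono)
        fix i assume "i \<in> {..<n}"
        then show "of_int m * \<theta> i - 1 / N \<le> of_int (p i)" using p[of i] by (simp add: abs_less_iff)
      qed
      finally have "real_of_int m - real n / N \<le> of_int (\<Sum>i<n. p i)" by simp
      moreover have "real n / N < 1" using N \<open>0 \<le> S\<close> \<open>0 < N\<close> by (simp add: field_simps)
      moreover have "1 \<le> real_of_int m" using \<open>0 < m\<close> by simp
      ultimately have "0 < real_of_int (\<Sum>i<n. p i)" by linarith
      then show ?thesis by linarith
    qed
    \<comment> \<open>the \<open>i\<close>-th comparison repeated \<open>p i\<close> times\<close>
    define A where "A = Sigma {..<n} (\<lambda>i. {..<nat (p i)})"
    have "finite A" unfolding A_def by simp
    have "A \<noteq> {}"
    proof
      assume "A = {}"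
      have "p i \<le> 0" if "i < n" for i
      proof (rule ccontr)
        assume "\<not> p i \<le> 0"
        then have "(i, 0) \<in> A" using that by (simp add: A_def)
        then show False using \<open>A = {}\<close> by simp
      qed
      then have "(\<Sum>i<n. p i) \<le> 0" by (intro sum_nonpos) auto
      then show False using \<open>0 < (\<Sum>i<n. p i)\<close> by simp
    qed
    have "(\<Sum>(i, j)\<in>A. fst (q i), \<Sum>(i, j)\<in>A. snd (q i)) \<in> R"
      by (rule sum_strict_mono_monomial_order[OF R \<open>finite A\<close> \<open>A \<noteq> {}\<close>])
        (use q(1) \<open>Q \<subseteq> R\<close> in \<open>auto simp: A_def\<close>)
    moreover have "(\<Sum>(i, j)\<in>A. fst (q i)) = (\<Sum>(i, j)\<in>A. snd (q i))"
    proof (rule poly_mapping_eqI)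
      fix k
      have sum_A: "real (lookup (\<Sum>(i, j)\<in>A. f i) k) = (\<Sum>i<n. of_int (p i) * real (lookup (f i) k))"
        for f :: "nat \<Rightarrow> 'v expo"
      proof -
        have "(\<Sum>(i, j)\<in>A. f i) = (\<Sum>i<n. \<Sum>j<nat (p i). f i)"
          unfolding A_def by (subst sum.Sigma) auto
        then show ?thesis by (auto simp: lookup_sum p_nonneg intro!: sum.cong)
      qed
      have "(\<Sum>i<n. of_int (p i) * real (lookup (snd (q i)) k)) - (\<Sum>i<n. of_int (p i) * real (lookup (fst (q i)) k))
          = (\<Sum>i<n. of_int (p i) * e i $ k)"
        by (auto simp: q(2)[symmetric] \<delta>_def right_diff_distrib sum_subtractf[symmetric] intro!: sum.cong)
      then have "real (lookup (\<Sum>(i, j)\<in>A. snd (q i)) k) = real (lookup (\<Sum>(i, j)\<in>A. fst (q i)) k)"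
        unfolding sum_A using cancel by simp
      then show "lookup (\<Sum>(i, j)\<in>A. fst (q i)) k = lookup (\<Sum>(i, j)\<in>A. snd (q i)) k" by simp
    qed
    ultimately show False using monomial_order_irrefl[OF R] by simp
  qed
  moreover have "closed (convex hull (\<delta> ` Q))"
    using \<open>finite Q\<close> by (intro compact_imp_closed compact_convex_hull finite_imp_compact) simp
  ultimately obtain v b where v: "0 < b" "\<And>x. x \<in> convex hull (\<delta> ` Q) \<Longrightarrow> b < v \<bullet> x"
    using separating_hyperplane_closed_0[of "convex hull (\<delta> ` Q)"] by auto
  have pos: "weight v (fst q) < weight v (snd q)" if "q \<in> Q" for q
  proof -
    have "b < v \<bullet> \<delta> q" using that by (intro v(2) hull_inc) simp
    then show ?thesis using v(1) by (simp add: weight_\<delta>)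
  qed
  have "0 < v $ i" for i
  proof -
    have "(0, single i 1) \<in> Q" by (simp add: Q_def)
    from pos[OF this] show ?thesis by (simp only: fst_conv snd_conv weight_zero weight_single)
  qed
  then have "v \<in> nonneg_weights" by (simp add: nonneg_weights_def less_imp_le)
  moreover have "weight v \<beta> < weight v \<alpha>" if "(\<beta>, \<alpha>) \<in> P" for \<beta> \<alpha>
    using pos[of "(\<beta>, \<alpha>)"] that by (simp add: Q_def)
  ultimately show ?thesis using that by blast
qed

text \<open>
  The closure in the definition of the cone turns the strict inequalities into weak ones. That no weak solution
  is lost needs one strict solution \<open>v\<close>, which exists because the inequalities are comparisons that hold in \<open>R\<close>.
\<close>

theorem groebner_cone_iff:
  fixes I :: "('v::finite, 'k::field) mpoly set"
  assumes I: "ideal.subspace I" and R: "monomial_order R"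
  shows "\<omega> \<in> groebner_cone R I \<longleftrightarrow> \<omega> \<in> nonneg_weights \<and>
    (\<forall>g\<in>reduced_GB R I. \<forall>\<beta>\<in>keys g. weight \<omega> \<beta> \<le> weight \<omega> (lead_expo R g))"
proof
  let ?C = "nonneg_weights \<inter>
    (\<Inter>g\<in>reduced_GB R I. \<Inter>\<beta>\<in>keys g. {\<omega>. weight \<omega> \<beta> \<le> weight \<omega> (lead_expo R g)})"
  have nonneg_eq: "nonneg_weights = (\<Inter>i. {\<omega> :: real ^ 'v. 0 \<le> \<omega> $ i})"
    by (auto simp: nonneg_weights_def)
  have "closed (nonneg_weights :: (real ^ 'v) set)"
    unfolding nonneg_eq by (intro closed_INT ballI closed_Collect_le continuous_intros)
  then have "closed ?C"
    unfolding weight_def by (intro closed_Int closed_INT ballI closed_Collect_le continuous_intros)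
  moreover have "{\<omega> \<in> nonneg_weights. wlead_ideal \<omega> I = lead_ideal R I} \<subseteq> ?C"
  proof
    fix w assume w: "w \<in> {\<omega> \<in> nonneg_weights. wlead_ideal \<omega> I = lead_ideal R I}"
    have "weight w \<beta> \<le> weight w (lead_expo R g)" if "g \<in> reduced_GB R I" "\<beta> \<in> keys g" for g \<beta>
      using wlead_ideal_eq_lead_ideal_imp_strict[OF I R _ that] w
      by (cases "\<beta> = lead_expo R g") (auto intro: less_imp_le)
    then show "w \<in> ?C" using w by blast
  qed
  ultimately have "groebner_cone R I \<subseteq> ?C" unfolding groebner_cone_def by (rule closure_minimal[rotated])
  moreover assume "\<omega> \<in> groebner_cone R I"
  ultimately show "\<omega> \<in> nonneg_weights \<and>
      (\<forall>g\<in>reduced_GB R I. \<forall>\<beta>\<in>keys g. weight \<omega> \<beta> \<le> weight \<omega> (lead_expo R g))" by blast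
next
  assume \<omega>: "\<omega> \<in> nonneg_weights \<and>
    (\<forall>g\<in>reduced_GB R I. \<forall>\<beta>\<in>keys g. weight \<omega> \<beta> \<le> weight \<omega> (lead_expo R g))"
  define P where
    "P = (\<Union>g\<in>reduced_GB R I. (\<lambda>\<beta>. (\<beta>, lead_expo R g)) ` (keys g - {lead_expo R g}))"
  have "finite (reduced_GB R I)"
    using reduced_elements_reduced_GB[OF I R] by (simp add: reduced_GB_eq[OF I R] groebner_basis_def)
  then have "finite P" unfolding P_def by simp
  moreover have "P \<subseteq> R"
    unfolding P_def using below_lead_expo[OF R] reduced_elementsD(2)[OF _ R]
    by (auto simp: reduced_GB_eq[OF I R])
  ultimately obtain v where v: "v \<in> nonneg_weights" "\<And>\<beta> \<alpha>. (\<beta>, \<alpha>) \<in> P \<Longrightarrow> weight v \<beta> < weight v \<alpha>"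
    using exists_weight_realising_comparisons[OF R] by blast
  \<comment> \<open>weak inequalities for \<open>\<omega>\<close> and strict ones for \<open>v\<close> add up to strict ones\<close>
  define w where "w k = \<omega> + (1 / real (Suc k)) *\<^sub>R v" for k
  have "w k \<in> {\<omega> \<in> nonneg_weights. wlead_ideal \<omega> I = lead_ideal R I}" for k
  proof -
    have nonneg: "w k \<in> nonneg_weights" using \<omega> v(1) by (auto simp: w_def nonneg_weights_def)
    moreover have "wlead_ideal (w k) I = lead_ideal R I"
    proof (rule strict_imp_wlead_ideal_eq_lead_ideal[OF I R nonneg])
      fix g \<beta> assume g: "g \<in> reduced_GB R I" "\<beta> \<in> keys g" "\<beta> \<noteq> lead_expo R g"
      have "weight \<omega> \<beta> \<le> weight \<omega> (lead_expo R g)" using \<omega> g by blast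
      moreover have "weight v \<beta> < weight v (lead_expo R g)" using g by (intro v(2)) (auto simp: P_def)
      then have "1 / real (Suc k) * weight v \<beta> < 1 / real (Suc k) * weight v (lead_expo R g)"
        by (intro mult_strict_left_mono) auto
      ultimately show "weight (w k) \<beta> < weight (w k) (lead_expo R g)"
        unfolding w_def weight_add_left weight_scaleR_left by linarith
    qed
    ultimately show ?thesis by blast
  qed
  moreover have "w \<longlonglongrightarrow> \<omega>"
  proof -
    have "w \<longlonglongrightarrow> \<omega> + 0 *\<^sub>R v"
      unfolding w_def by (intro tendsto_intros LIMSEQ_Suc[OF lim_1_over_n])
    then show ?thesis by simp
  qed
  ultimately show "\<omega> \<in> groebner_cone R I"
    unfolding groebner_cone_def closure_sequential by blast
qed

section \<open>Star-shapedness\<close>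

lemma weight_mem_groebner_cone_refine:
  fixes I :: "('v::finite, 'k::field) mpoly set"
  assumes I: "ideal.subspace I" and R: "monomial_order R" and \<omega>: "\<omega> \<in> nonneg_weights"
  shows "\<omega> \<in> groebner_cone (refine_by_weight \<omega> R) I"
proof -
  let ?R = "refine_by_weight \<omega> R"
  have R': "monomial_order ?R" using R \<omega> by (rule monomial_order_refine_by_weight)
  have "weight \<omega> \<beta> \<le> weight \<omega> (lead_expo ?R g)" if g: "g \<in> reduced_GB ?R I" "\<beta> \<in> keys g" for g \<beta>
  proof -
    have "g \<noteq> 0" using g(2) by auto
    then show ?thesis
      using below_lead_expo[OF R' _ g(2)]
      by (cases "\<beta> = lead_expo ?R g") (auto simp: refine_by_weight_iff)
  qed
  then show ?thesis using \<omega> by (simp add: groebner_cone_iff[OF I R'])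
qed

text \<open>
  On the reduced Groebner basis the weight \<open>s\<close> never contradicts the choice of leading monomials made by \<open>R\<close>.
\<close>

lemma specific_elim_order_refine_in_cone:
  fixes I :: "('v::finite, 'k::field) mpoly set"
  assumes I: "ideal.subspace I" and R: "specific_elim_order U I R" and s: "s \<in> groebner_cone R I"
  shows "specific_elim_order U I (refine_by_weight s R)"
proof -
  have mo: "monomial_order R" using R by (simp add: specific_elim_order_def)
  have s': "s \<in> nonneg_weights"
      "\<And>g \<beta>. g \<in> reduced_GB R I \<Longrightarrow> \<beta> \<in> keys g \<Longrightarrow> weight s \<beta> \<le> weight s (lead_expo R g)"
    using s by (auto simp: groebner_cone_iff[OF I mo])
  have mo': "monomial_order (refine_by_weight s R)"
    using mo s'(1) by (rule monomial_order_refine_by_weight)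
  show ?thesis
  proof (rule specific_elim_order_if_same_leads_on_GB[OF I R mo'])
    fix g assume g: "g \<in> reduced_GB R I"
    have "g \<noteq> 0" using g reduced_elementsD(2)[OF _ mo] by (simp add: reduced_GB_eq[OF I mo])
    show "lead_expo (refine_by_weight s R) g = lead_expo R g"
    proof (rule lead_expo_eqI[OF mo'])
      show "lead_expo R g \<in> keys g" by (rule lead_expo_in_keys[OF mo \<open>g \<noteq> 0\<close>])
      fix \<beta> assume \<beta>: "\<beta> \<in> keys g" "\<beta> \<noteq> lead_expo R g"
      show "(\<beta>, lead_expo R g) \<in> refine_by_weight s R"
        using s'(2)[OF g \<beta>(1)] below_lead_expo[OF mo \<open>g \<noteq> 0\<close> \<beta>] by (auto simp: refine_by_weight_iff)
    qed
  qed
qed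

text \<open>
  The step that uses the shape of the centre: \<open>c\<close> vanishes on the exponents of \<open>K[X]\<close> and is nonnegative on all others.
  Hence whatever lies below a monomial of \<open>K[X]\<close> in the new order lies below it in the old one (\<open>down\<close>), and among
  the monomials of \<open>K[X]\<close> the converse holds as well (\<open>up\<close>).
\<close>

lemma specific_elim_order_refine_towards_center:
  fixes I :: "('v::finite, 'k::field) mpoly set"
  assumes I: "ideal.subspace I" and R: "monomial_order R"
    and s: "s \<in> nonneg_weights" and c: "c \<in> nonneg_weights" "\<forall>i. i \<notin> U \<longrightarrow> c $ i = 0"
    and t: "0 \<le> t"
    and spec: "specific_elim_order U I (refine_by_weight s R)"
  shows "specific_elim_order U I (refine_by_weight (c + t *\<^sub>R s) (refine_by_weight s R))"
proof -
  let ?p = "c + t *\<^sub>R s" and ?X = "expos_without U"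
  let ?R1 = "refine_by_weight s R"
  let ?R2 = "refine_by_weight ?p ?R1"
  have p: "?p \<in> nonneg_weights" using s c(1) t by (simp add: nonneg_weights_def)
  have R1: "monomial_order ?R1" using R s by (rule monomial_order_refine_by_weight)
  have R2: "monomial_order ?R2" using R1 p by (rule monomial_order_refine_by_weight)
  have weight_p: "weight ?p \<alpha> = weight c \<alpha> + t * weight s \<alpha>" for \<alpha>
    by (simp add: weight_add_left weight_scaleR_left)
  have down: "(\<beta>, \<alpha>) \<in> ?R1" if "\<alpha> \<in> ?X" "(\<beta>, \<alpha>) \<in> ?R2" for \<alpha> \<beta>
  proof (cases "weight ?p \<beta> < weight ?p \<alpha>")
    case True
    then have "t * weight s \<beta> < t * weight s \<alpha>"
      using weight_eq_zero[OF that(1) c(2)] weight_nonneg[OF c(1), of \<beta>] by (simp add: weight_p)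
    then have "weight s \<beta> < weight s \<alpha>" using t by (simp add: mult_less_cancel_left)
    then show ?thesis by (simp add: refine_by_weight_iff)
  next
    case False
    then show ?thesis using that(2) by (simp add: refine_by_weight_iff[of _ _ ?p])
  qed
  have up: "(\<beta>, \<alpha>) \<in> ?R2" if "\<alpha> \<in> ?X" "\<beta> \<in> ?X" "(\<beta>, \<alpha>) \<in> ?R1" for \<alpha> \<beta>
  proof -
    have "weight s \<beta> \<le> weight s \<alpha>" using that(3) by (auto simp: refine_by_weight_iff)
    then have "t * weight s \<beta> \<le> t * weight s \<alpha>" using t by (rule mult_left_mono)
    then have "weight ?p \<beta> \<le> weight ?p \<alpha>"
      using weight_eq_zero[OF that(1) c(2)] weight_eq_zero[OF that(2) c(2)] by (simp add: weight_p)
    then show ?thesis using that(3) by (auto simp: refine_by_weight_iff[of _ _ ?p])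
  qed
  show ?thesis
    unfolding specific_elim_order_iff[OF I R2]
  proof
    fix \<alpha> assume \<alpha>: "\<alpha> \<in> lead_expos ?R2 I \<inter> ?X"
    then obtain f where f: "f \<in> I" "f \<noteq> 0" "lead_expo ?R2 f = \<alpha>" by (auto simp: lead_expos_def)
    have "lead_expo ?R1 f = \<alpha>"
      using lead_expo_in_keys[OF R2 f(2)] below_lead_expo[OF R2 f(2)] f(3) \<alpha> down
      by (intro lead_expo_eqI[OF R1]) auto
    then have "\<alpha> \<in> lead_expos ?R1 I \<inter> ?X" using lead_exposI[OF f(1,2), of ?R1] \<alpha> by simp
    then obtain h where h: "h \<in> I" "h \<noteq> 0" "keys h \<subseteq> ?X" "lead_expo ?R1 h = \<alpha>"
      using spec unfolding specific_elim_order_iff[OF I R1] by blast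
    have "lead_expo ?R2 h = \<alpha>"
      using lead_expo_in_keys[OF R1 h(2)] below_lead_expo[OF R1 h(2)] h(3,4) \<alpha> up
      by (intro lead_expo_eqI[OF R2]) auto
    then show "\<exists>h\<in>I. h \<noteq> 0 \<and> keys h \<subseteq> ?X \<and> lead_expo ?R2 h = \<alpha>" using h by blast
  qed
qed

text \<open>
  The lexicographic order with respect to an enumeration of the variables.
\<close>

lemma exists_monomial_order: "\<exists>R :: ('v::finite) expo rel. monomial_order R"
proof -
  let ?R = "{(\<alpha>, \<beta>). \<exists>i. lookup \<alpha> i < lookup \<beta> i \<and>
    (\<forall>j. to_nat j < to_nat i \<longrightarrow> lookup \<alpha> j = lookup \<beta> j)} :: 'v expo rel"
  have "trans ?R"
  proof (rule transI)
    fix \<alpha> \<beta> \<gamma> assume "(\<alpha>, \<beta>) \<in> ?R" "(\<beta>, \<gamma>) \<in> ?R"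
    then obtain i k where i: "lookup \<alpha> i < lookup \<beta> i" "\<forall>j. to_nat j < to_nat i \<longrightarrow> lookup \<alpha> j = lookup \<beta> j"
      and k: "lookup \<beta> k < lookup \<gamma> k" "\<forall>j. to_nat j < to_nat k \<longrightarrow> lookup \<beta> j = lookup \<gamma> j" by auto
    consider "i = k" | "to_nat i < to_nat k" | "to_nat k < to_nat i"
      by (metis linorder_neqE_nat to_nat_split)
    then show "(\<alpha>, \<gamma>) \<in> ?R"
    proof cases
      case 1
      then show ?thesis using i k by (auto intro!: exI[of _ i])
    next
      case 2
      then show ?thesis using i k by (auto intro!: exI[of _ i])
    next
      case 3
      then show ?thesis using i k by (auto intro!: exI[of _ k])
    qed
  qed
  moreover have "irrefl ?R" by (auto simp: irrefl_def)
  moreover have total: "(\<alpha>, \<beta>) \<in> ?R \<or> (\<beta>, \<alpha>) \<in> ?R" if "\<alpha> \<noteq> \<beta>" for \<alpha> \<beta>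
  proof -
    obtain i0 where "lookup \<alpha> i0 \<noteq> lookup \<beta> i0" using \<open>\<alpha> \<noteq> \<beta>\<close> poly_mapping_eqI[of \<alpha> \<beta>] by auto
    then obtain i where i: "lookup \<alpha> i \<noteq> lookup \<beta> i"
        "\<And>j. lookup \<alpha> j \<noteq> lookup \<beta> j \<Longrightarrow> to_nat i \<le> to_nat j"
      using ex_has_least_nat[of "\<lambda>i. lookup \<alpha> i \<noteq> lookup \<beta> i" i0 to_nat] by auto
    have "\<forall>j. to_nat j < to_nat i \<longrightarrow> lookup \<alpha> j = lookup \<beta> j" by (meson i(2) leD)
    then show ?thesis using i(1) by (auto simp: neq_iff)
  qed
  moreover have "(0, \<alpha>) \<in> ?R" if "\<alpha> \<noteq> 0" for \<alpha>
    using total[OF that] by auto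
  moreover have "(\<alpha> + \<gamma>, \<beta> + \<gamma>) \<in> ?R" if "(\<alpha>, \<beta>) \<in> ?R" for \<alpha> \<beta> \<gamma>
    using that by (auto simp: lookup_add)
  ultimately have "monomial_order ?R"
    by (auto simp: monomial_order_def strict_linear_order_on_def total_on_def)
  then show ?thesis by blast
qed

text \<open>
  Comparing total degrees in the \<open>U\<close>-variables first yields an order for which any polynomial with leading monomial in
  \<open>K[X]\<close> lies in \<open>K[X]\<close>.
\<close>

lemma exists_specific_elim_order:
  fixes I :: "('v::finite, 'k::field) mpoly set"
  assumes I: "ideal.subspace I"
  shows "\<exists>R. specific_elim_order U I R"
proof -
  obtain R0 :: "'v expo rel" where R0: "monomial_order R0" using exists_monomial_order by blast
  define \<omega> :: "real ^ 'v" where "\<omega> = (\<chi> i. if i \<in> U then 1 else 0)"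
  have \<omega>: "\<omega> \<in> nonneg_weights" by (simp add: \<omega>_def nonneg_weights_def)
  let ?R = "refine_by_weight \<omega> R0"
  have R: "monomial_order ?R" using R0 \<omega> by (rule monomial_order_refine_by_weight)
  have zero: "weight \<omega> \<alpha> = 0 \<longleftrightarrow> \<alpha> \<in> expos_without U" for \<alpha>
    by (auto simp: \<omega>_def weight_def inner_vec_def expos_without_def sum_nonneg_eq_0_iff in_keys_iff disjoint_iff)
  have "specific_elim_order U I ?R"
    unfolding specific_elim_order_iff[OF I R]
  proof
    fix \<alpha> assume \<alpha>: "\<alpha> \<in> lead_expos ?R I \<inter> expos_without U"
    then obtain f where f: "f \<in> I" "f \<noteq> 0" "lead_expo ?R f = \<alpha>" by (auto simp: lead_expos_def)
    have "\<beta> \<in> expos_without U" if "\<beta> \<in> keys f" for \<beta>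
    proof (cases "\<beta> = \<alpha>")
      case False
      then have "(\<beta>, \<alpha>) \<in> ?R" using below_lead_expo[OF R f(2) that] f(3) by simp
      moreover have "weight \<omega> \<alpha> = 0" using \<alpha> zero by simp
      ultimately have "weight \<omega> \<beta> \<le> 0" by (auto simp: refine_by_weight_iff)
      then show ?thesis using weight_nonneg[OF \<omega>, of \<beta>] zero by auto
    qed (use \<alpha> in simp)
    then show "\<exists>h\<in>I. h \<noteq> 0 \<and> keys h \<subseteq> expos_without U \<and> lead_expo ?R h = \<alpha>" using f by blast
  qed
  then show ?thesis by blast
qed

theorem theorem1:
  fixes I :: "('v::finite, 'k::field) mpoly set" and U :: "'v set"
  assumes "ideal.subspace I"
  shows "star_shaped
    (\<Union>{groebner_cone R I | R. specific_elim_order U I R})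
    {\<omega> \<in> nonneg_weights. \<forall>i. i \<notin> U \<longrightarrow> \<omega> $ i = 0}"
    (is "star_shaped ?S ?C")
proof -
  have segment: "(1 - t) *\<^sub>R c + t *\<^sub>R s \<in> ?S"
    if R: "specific_elim_order U I R" and s: "s \<in> groebner_cone R I" and c: "c \<in> ?C"
      and t: "0 \<le> t" "t \<le> 1" for R s c t
  proof -
    let ?p = "(1 - t) *\<^sub>R c + t *\<^sub>R s"
    let ?R = "refine_by_weight ?p (refine_by_weight s R)"
    have mo: "monomial_order R" using R by (simp add: specific_elim_order_def)
    have s': "s \<in> nonneg_weights" using s by (simp add: groebner_cone_iff[OF assms mo])
    have c': "(1 - t) *\<^sub>R c \<in> nonneg_weights" "\<forall>i. i \<notin> U \<longrightarrow> ((1 - t) *\<^sub>R c) $ i = 0"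
      using c t by (auto simp: nonneg_weights_def)
    have p: "?p \<in> nonneg_weights" using c' s' t by (auto simp: nonneg_weights_def)
    have "specific_elim_order U I (refine_by_weight s R)"
      using assms R s by (rule specific_elim_order_refine_in_cone)
    then have "specific_elim_order U I ?R"
      by (rule specific_elim_order_refine_towards_center[OF assms mo s' c' t(1)])
    moreover have "?p \<in> groebner_cone ?R I"
      using monomial_order_refine_by_weight[OF mo s'] p by (rule weight_mem_groebner_cone_refine[OF assms])
    ultimately show ?thesis by blast
  qed
  obtain R where R: "specific_elim_order U I R" using exists_specific_elim_order[OF assms] by blast
  have "monomial_order R" using R by (simp add: specific_elim_order_def)
  \<comment> \<open>\<open>0\<close> lies in every Groebner cone, so the centre consists of end points of segments that start in \<open>?S\<close>.\<close>
  then have "0 \<in> groebner_cone R I"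
    by (simp add: groebner_cone_iff[OF assms] nonneg_weights_def weight_def)
  then have "c \<in> ?S" if "c \<in> ?C" for c
    using segment[OF R _ that, of 0 0] by simp
  moreover have "closed_segment c s \<subseteq> ?S" if "s \<in> ?S" "c \<in> ?C" for s c
    using that segment by (fastforce simp: closed_segment_def)
  ultimately show ?thesis unfolding star_shaped_def by blast
qed

end
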